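(* Let $T>0$ and $\Lambda=(0,1)$. Let $G^{\ast}:[0,T]\times L^2(\Lambda)\to L^2(\Lambda)$ be an optimal feedback (as defined in the context) which is continuous and satisfies the linear growth condition $\|G^{\ast}(t,u)\|_{L^2(\Lambda)}\le C(1+\|u\|_{L^2(\Lambda)})$ for all $(t,u)\in[0,T]\times L^2(\Lambda)$ and some constant $C>0$. Let $\theta:\mathbb{R}\to\mathbb{R}$ be Lipschitz continuous and not a polynomial, and let $\theta$ act componentwise on vectors. For $n,k\in\mathbb{N}$ let $\mathcal{N}^n_k$ be the set of all one-layer neural networks $\psi:\mathbb{R}\times\mathbb{R}^{n+1}\to\mathbb{R}^{n+1}$ of the form $$\psi(t,x)=B\,\theta\left(A\begin{pmatrix} t \\ x \end{pmatrix}+a\right),\qquad A\in\mathbb{R}^{k\times(n+2)},\ a\in\mathbb{R}^k,\ B\in\mathbb{R}^{(n+1)\times k},$$ and let $\mathcal{N}^n:=\bigcup_{k=1}^\infty\mathcal{N}^n_k$. For $l\in\mathbb{N}$ with $l\ge 1$ let $\eta^l(x)=x$ if $|x|\le l$ and $\eta^l(x)=l\,x/|x|$ if $|x|>l$, for $x\in\mathbb{R}^{n+1}$, where $|\cdot|$ is the Euclidean norm. Let $\mathbb{U}$ be the set of all maps $G:[0,T]\times L^2(\Lambda)\to L^2(\Lambda)$ of the form $$G(t,u)=\sum_{i=0}^n\psi\big(t,\eta^l(\langle u,e_0\rangle_{L^2(\Lambda)},\dots,\langle u,e_n\rangle_{L^2(\Lambda)})\big)_i\,e_i,\qquad \psi\in\mathcal{N}^n,\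 n,l\in\mathbb{N},\ l\ge1,$$ where the components of vectors in $\mathbb{R}^{n+1}$ are indexed by $0,\dots,n$. Then $\mathbb{U}\subset U_{\mathrm{ad}}$, and $\mathbb{U}$ satisfies the uniform approximation property with respect to $G^{\ast}$.
   Context: **Basis and finitely based approximations.** Let $e_0=1$ and $e_k=\sqrt{2}\cos(k\pi\,\cdot\,)$ for $k\ge1$, which is an orthonormal basis of $L^2(\Lambda)$, $\Lambda=(0,1)$. Let $S_n=\mathrm{span}\{e_0,\dots,e_n\}$ and let $P_n:L^2(\Lambda)\to S_n$ be the orthogonal projection. For $G:[0,T]\times L^2(\Lambda)\to L^2(\Lambda)$, the finitely based approximation of $G$ is $G^n(t,u):=P_nG(t,P_nu)$. **State equation.** $(W_t)_{t\in[0,T]}$ is a cylindrical Wiener process on $L^2(\Lambda)$ on a probability space $(\Omega,\mathcal{A},\mathbb{P})$. The operator $\sigma:L^2(\Lambda)\to L^2(\Lambda)$ is Hilbert-Schmidt. $\Delta$ is the Laplacian with Neumann boundary conditions (Gelfand triple $H^1(\Lambda)\hookrightarrow L^2(\Lambda)\hookrightarrow (H^1(\Lambda))^{\ast}$). $\mathcal{F}$ is the Nemytskii operator $\mathcal{F}(u)(x)=f(u(x))$ of a function $f:\mathbb{R}\to\mathbb{R}$. The initial state $u_0\in L^2(\Lambda)$ is fixed. For a feedback $G:[0,T]\times L^2(\Lambda)\to L^2(\Lambda)$, $u^G$ denotes the solution of $$\mathrm{d}u^G_t=[\Delta u^G_t+\mathcal{F}(u^G_t)+G(t,u^G_t)]\,\mathrm{d}t+\sigma\,\mathrm{d}W_t,\quad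 t\in[0,T],\qquad u^G_0=u_0.$$ For an adapted control process $\mathfrak{g}:[0,T]\times\Omega\to L^2(\Lambda)$, $u^{\mathfrak{g}}$ denotes the solution of the same equation with $G(t,u^G_t)$ replaced by $\mathfrak{g}_t$. Standing assumption on the equation: whenever $G:[0,T]\times L^2(\Lambda)\to L^2(\Lambda)$ is continuous and Lipschitz continuous in $u$ uniformly in $t$, the state equation has a unique strong (adapted) solution $u^G$, and $u^G\in L^2([0,T]\times\Omega;L^2(\Lambda))$. **Admissible controls.** Let $\mathbb{A}=L^2([0,T]\times\Omega;L^2(\Lambda))$ (adapted processes). There are no control constraints, and $$U_{\mathrm{ad}}:=\{G:[0,T]\times L^2(\Lambda)\to L^2(\Lambda)\mid G(\cdot,u^G_\cdot)\in\mathbb{A}\},$$ where membership includes that the state equation for $G$ has a unique strong solution $u^G$. **Optimal feedback.** The running cost $l:[0,T]\times\Lambda\times\mathbb{R}\to\mathbb{R}$ and the terminal cost $m:\Lambda\times\mathbb{R}\to\mathbb{R}$ are differentiable and locally Lipschitz continuous in the last variable, $\nu$ is a regularization constant, and $$J(\mathfrak{g})=\mathbb{E}\left[\int_0^T\left(\int_\Lambda l(t,x,u^{\mathfrak{g}}_t(x))\,\mathrm{d}x+\frac{\nu}{2}\|\mathfrak{g}_t\|^2_{L^2(\Lambda)}\right)\mathrm{d}t+\int_\Lambda m(x,u^{\mathfrak{g}}_T(x))\,\mathrm{d}x\right].$$ A map $G^{\ast}:[0,T]\times L^2(\Lambda)\to L^2(\Lambda)$ is an optimal feedback if the state equation with $G=G^{\ast}$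 has a unique strong solution $u^{G^{\ast}}$ and the process $\mathfrak{g}^{\ast}_t=G^{\ast}(t,u^{G^{\ast}}_t)$ belongs to $\mathbb{A}$ and minimizes $J$ over $\mathbb{A}$. (The functions $l,m$ here are unrelated to the integer indices $l,m$ used elsewhere.) **Uniform approximation property.** A subset $\mathbb{U}\subset U_{\mathrm{ad}}$ satisfies the uniform approximation property with respect to $G:[0,T]\times L^2(\Lambda)\to L^2(\Lambda)$ if there exists a family $(G^{n,m})_{n,m\in\mathbb{N}}\subset\mathbb{U}$ such that: (i) for every $n\in\mathbb{N}$ there is a constant $C_n>0$ with $\|G^{n,m}(t,u)\|_{L^2(\Lambda)}\le C_n(1+\|u\|_{L^2(\Lambda)})$ for all $m\in\mathbb{N}$ and $(t,u)\in[0,T]\times L^2(\Lambda)$; and (ii) for every $R>0$ and $n\in\mathbb{N}$, $$\lim_{m\to\infty}\ \sup_{t\in[0,T],\ \|u\|_{L^2(\Lambda)}\le R}\|G^n(t,u)-G^{n,m}(t,u)\|^2_{L^2(\Lambda)}=0,$$ where $G^n(t,u)=P_nG(t,P_nu)$. *)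

theory Defs
  imports "HOL-Probability.Probability" "Jordan_Normal_Form.Matrix"
begin

section \<open>The Hilbert space of square-integrable functions on the unit interval\<close>

abbreviation Lam :: "real measure" where
  "Lam \<equiv> lebesgue_on {0<..<1}"

definition square_integrable :: "(real \<Rightarrow> real) \<Rightarrow> bool" where
  "square_integrable f \<longleftrightarrow> f \<in> borel_measurable Lam \<and> integrable Lam (\<lambda>x. (f x)\<^sup>2)"

definition L2_rel :: "(real \<Rightarrow> real) \<Rightarrow> (real \<Rightarrow> real) \<Rightarrow> bool" where
  "L2_rel f g \<longleftrightarrow> square_integrable f \<and> square_integrable g \<and> (AE x in Lam. f x = g x)"

lemma square_integrable_zero: "square_integrable (\<lambda>x. 0)"
  by (simp add: square_integrable_def)

lemma square_integrable_mult:
  assumes "square_integrable f" "square_integrable g"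
  shows "integrable Lam (\<lambda>x. f x * g x)"
proof (rule Bochner_Integration.integrable_bound)
  show "integrable Lam (\<lambda>x. (f x)\<^sup>2 + (g x)\<^sup>2)"
    using assms by (auto simp: square_integrable_def)
  show "(\<lambda>x. f x * g x) \<in> borel_measurable Lam"
    using assms by (auto simp: square_integrable_def)
  have "\<bar>a * b\<bar> \<le> a\<^sup>2 + b\<^sup>2" for a b :: real
  proof -
    have "0 \<le> (\<bar>a\<bar> - \<bar>b\<bar>)\<^sup>2" by simp
    then have "2 * (\<bar>a\<bar> * \<bar>b\<bar>) \<le> a\<^sup>2 + b\<^sup>2"
      unfolding power2_diff by simp
    moreover have "0 \<le> \<bar>a\<bar> * \<bar>b\<bar>" by simp
    ultimately show ?thesis unfolding abs_mult by linarith
  qed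
  then show "AE x in Lam. norm (f x * g x) \<le> norm ((f x)\<^sup>2 + (g x)\<^sup>2)"
    by auto
qed

lemma square_integrable_add:
  assumes "square_integrable f" "square_integrable g"
  shows "square_integrable (\<lambda>x. f x + g x)"
proof -
  have "integrable Lam (\<lambda>x. (f x)\<^sup>2 + (g x)\<^sup>2 + 2 * (f x * g x))"
    using assms square_integrable_mult[OF assms] by (auto simp: square_integrable_def)
  moreover have "(\<lambda>x. (f x + g x)\<^sup>2) = (\<lambda>x. (f x)\<^sup>2 + (g x)\<^sup>2 + 2 * (f x * g x))"
    by (auto simp: power2_sum)
  ultimately show ?thesis
    using assms by (auto simp: square_integrable_def)
qed

lemma square_integrable_cmult:
  assumes "square_integrable f"
  shows "square_integrable (\<lambda>x. c * f x)"
  using assms by (auto simp: square_integrable_def power_mult_distrib)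

lemma square_integrable_minus:
  assumes "square_integrable f"
  shows "square_integrable (\<lambda>x. - f x)"
  using square_integrable_cmult[OF assms, of "-1"] by simp

lemma square_integrable_diff:
  assumes "square_integrable f" "square_integrable g"
  shows "square_integrable (\<lambda>x. f x - g x)"
  using square_integrable_add[OF assms(1) square_integrable_minus[OF assms(2)]] by simp

quotient_type L2 = "real \<Rightarrow> real" / partial: L2_rel
proof (rule part_equivpI)
  show "\<exists>f. L2_rel f f"
    using square_integrable_zero by (auto simp: L2_rel_def)
  show "symp L2_rel"
    by (auto simp: symp_def L2_rel_def)
  show "transp L2_rel"
  proof (rule transpI)
    fix f g h assume "L2_rel f g" "L2_rel g h"
    moreover from this have "AE x in Lam. f x = g x" "AE x in Lam. g x = h x"
      by (auto simp: L2_rel_def)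
    then have "AE x in Lam. f x = h x"
      by eventually_elim simp
    ultimately show "L2_rel f h" by (auto simp: L2_rel_def)
  qed
qed

instantiation L2 :: real_vector
begin

lift_definition zero_L2 :: L2 is "\<lambda>x. 0"
  by (simp add: L2_rel_def square_integrable_zero)

lift_definition plus_L2 :: "L2 \<Rightarrow> L2 \<Rightarrow> L2" is "\<lambda>f g x. f x + g x"
  by (auto simp: L2_rel_def intro: square_integrable_add)

lift_definition minus_L2 :: "L2 \<Rightarrow> L2 \<Rightarrow> L2" is "\<lambda>f g x. f x - g x"
  by (auto simp: L2_rel_def intro: square_integrable_diff)

lift_definition uminus_L2 :: "L2 \<Rightarrow> L2" is "\<lambda>f x. - f x"
  by (auto simp: L2_rel_def intro: square_integrable_minus)

lift_definition scaleR_L2 :: "real \<Rightarrow> L2 \<Rightarrow> L2" is "\<lambda>c f x. c * f x"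
  by (auto simp: L2_rel_def intro: square_integrable_cmult)

instance
proof
  fix u v w :: L2 and a b :: real
  show "u + v + w = u + (v + w)"
    by transfer (auto simp: L2_rel_def add.assoc intro!: square_integrable_add)
  show "u + v = v + u"
    by transfer (auto simp: L2_rel_def add.commute intro!: square_integrable_add)
  show "0 + u = u"
    by transfer (auto simp: L2_rel_def)
  show "- u + u = 0"
    by transfer (auto simp: L2_rel_def square_integrable_zero)
  show "u - v = u + - v"
    by transfer (auto simp: L2_rel_def intro!: square_integrable_diff)
  show "a *\<^sub>R (u + v) = a *\<^sub>R u + a *\<^sub>R v"
    by transfer (auto simp: L2_rel_def distrib_left
        intro!: square_integrable_add square_integrable_cmult)
  show "(a + b) *\<^sub>R u = a *\<^sub>R u + b *\<^sub>R u"
    by transfer (auto simp: L2_rel_def distrib_right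
        intro!: square_integrable_add square_integrable_cmult)
  show "a *\<^sub>R b *\<^sub>R u = (a * b) *\<^sub>R u"
    by transfer (auto simp: L2_rel_def mult.assoc intro!: square_integrable_cmult)
  show "1 *\<^sub>R u = u"
    by transfer (auto simp: L2_rel_def)
qed

end

instantiation L2 :: real_inner
begin

lift_definition inner_L2 :: "L2 \<Rightarrow> L2 \<Rightarrow> real" is "\<lambda>f g. \<integral>x. f x * g x \<partial>Lam"
proof -
  fix f f' g g' assume "L2_rel f f'" "L2_rel g g'"
  then show "(\<integral>x. f x * g x \<partial>Lam) = (\<integral>x. f' x * g' x \<partial>Lam)"
    by (intro integral_cong_AE) (auto simp: L2_rel_def square_integrable_def)
qed

definition norm_L2 :: "L2 \<Rightarrow> real" where "norm_L2 u = sqrt (inner u u)"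
definition sgn_L2 :: "L2 \<Rightarrow> L2" where "sgn_L2 u = u /\<^sub>R norm u"
definition dist_L2 :: "L2 \<Rightarrow> L2 \<Rightarrow> real" where "dist_L2 u v = norm (u - v)"
definition uniformity_L2 :: "(L2 \<times> L2) filter" where
  "uniformity_L2 = (INF e\<in>{0<..}. principal {(x, y). dist x y < e})"
definition open_L2 :: "L2 set \<Rightarrow> bool" where
  "open_L2 U \<longleftrightarrow> (\<forall>x\<in>U. \<forall>\<^sub>F (x', y) in uniformity. x' = x \<longrightarrow> y \<in> U)"

instance
proof
  fix u v w :: L2 and a :: real
  show "sgn u = u /\<^sub>R norm u" by (rule sgn_L2_def)
  show "dist u v = norm (u - v)" by (rule dist_L2_def)
  show "uniformity = (INF e\<in>{0<..}. principal {(x, y :: L2). dist x y < e})"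
    by (rule uniformity_L2_def)
  show "open U \<longleftrightarrow> (\<forall>x\<in>U. \<forall>\<^sub>F (x', y) in uniformity. x' = x \<longrightarrow> y \<in> U)" for U :: "L2 set"
    by (rule open_L2_def)
  show "inner u v = inner v u"
    by transfer (simp add: mult.commute)
  show "inner (u + v) w = inner u w + inner v w"
    by transfer (simp add: L2_rel_def distrib_right square_integrable_mult)
  show "inner (a *\<^sub>R u) v = a * inner u v"
    by transfer (simp add: mult.assoc)
  show "0 \<le> inner u u"
    by transfer simp
  show "inner u u = 0 \<longleftrightarrow> u = 0"
  proof transfer
    fix f assume "L2_rel f f"
    then have f: "square_integrable f" by (simp add: L2_rel_def)
    have "(\<integral>x. f x * f x \<partial>Lam) = 0 \<longleftrightarrow> (AE x in Lam. f x * f x = 0)"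
      by (intro integral_nonneg_eq_0_iff_AE square_integrable_mult f) simp
    then show "(\<integral>x. f x * f x \<partial>Lam) = 0 \<longleftrightarrow> L2_rel f (\<lambda>x. 0)"
      using f by (simp add: L2_rel_def square_integrable_zero)
  qed
  show "norm u = sqrt (inner u u)" by (rule norm_L2_def)
qed

end

lemma square_integrable_rep_L2: "square_integrable (rep_L2 u)"
  using Quotient3_rel_rep[OF Quotient3_L2, of u u] by (simp add: L2_rel_def)

lemma inner_L2_eq_integral: "inner u v = (\<integral>x. rep_L2 u x * rep_L2 v x \<partial>Lam)"
  by (simp add: inner_L2.rep_eq)

section \<open>Cosine basis and finitely based approximations\<close>

definition e_basis :: "nat \<Rightarrow> L2" where
  "e_basis k = abs_L2 (if k = 0 then (\<lambda>x. 1) else (\<lambda>x. sqrt 2 * cos (real k * pi * x)))"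

definition S_space :: "nat \<Rightarrow> L2 set" where
  "S_space n = span (e_basis ` {..n})"

definition P_proj :: "nat \<Rightarrow> L2 \<Rightarrow> L2" where
  "P_proj n u = (THE p. p \<in> S_space n \<and> (\<forall>w\<in>S_space n. inner (u - p) w = 0))"

definition finitely_based :: "(real \<Rightarrow> L2 \<Rightarrow> L2) \<Rightarrow> nat \<Rightarrow> real \<Rightarrow> L2 \<Rightarrow> L2" where
  "finitely_based G n t u = P_proj n (G t (P_proj n u))"

section \<open>The Sobolev space and the Neumann Laplacian\<close>

definition test_function :: "(real \<Rightarrow> real) \<Rightarrow> bool" where
  "test_function \<phi> \<longleftrightarrow>
     (\<forall>k x. ((deriv ^^ k) \<phi>) field_differentiable (at x)) \<and>
     (\<exists>K. compact K \<and> K \<subseteq> {0<..<1} \<and> (\<forall>x. x \<notin> K \<longrightarrow> \<phi> x = 0))"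

definition has_weak_deriv :: "L2 \<Rightarrow> L2 \<Rightarrow> bool" where
  "has_weak_deriv u w \<longleftrightarrow>
     (\<forall>\<phi>. test_function \<phi> \<longrightarrow>
        (\<integral>x. rep_L2 u x * deriv \<phi> x \<partial>Lam) = - (\<integral>x. rep_L2 w x * \<phi> x \<partial>Lam))"

definition H1 :: "L2 set" where
  "H1 = {u. \<exists>w. has_weak_deriv u w}"

definition weak_deriv :: "L2 \<Rightarrow> L2" where
  "weak_deriv u = (THE w. has_weak_deriv u w)"

definition H1_norm :: "L2 \<Rightarrow> real" where
  "H1_norm u = sqrt ((norm u)\<^sup>2 + (norm (weak_deriv u))\<^sup>2)"

text \<open>Elements of the dual of \<^const>\<open>H1\<close> are represented by their action on \<^const>\<open>H1\<close>.
  The Neumann Laplacian is the operator from \<^const>\<open>H1\<close> to its dual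
  given by the form below; the boundary condition is encoded in the choice of \<^const>\<open>H1\<close>
  (no vanishing trace) as test space.\<close>

definition neumann_laplacian :: "L2 \<Rightarrow> L2 \<Rightarrow> real" where
  "neumann_laplacian u v = - inner (weak_deriv u) (weak_deriv v)"

definition nemytskii :: "(real \<Rightarrow> real) \<Rightarrow> L2 \<Rightarrow> real \<Rightarrow> real" where
  "nemytskii f u x = f (rep_L2 u x)"

definition nemytskii_dual :: "(real \<Rightarrow> real) \<Rightarrow> L2 \<Rightarrow> L2 \<Rightarrow> real" where
  "nemytskii_dual f u v = (\<integral>x. nemytskii f u x * rep_L2 v x \<partial>Lam)"

text \<open>Bochner integrability on \<open>[0, T]\<close> of a map with values in the dual of \<^const>\<open>H1\<close>.
  Since that dual is separable and reflexive, strong measurability is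
  measurability of all the evaluations, and the Bochner integral is computed by integrating
  the evaluations.\<close>

definition dual_integrable :: "real \<Rightarrow> (real \<Rightarrow> L2 \<Rightarrow> real) \<Rightarrow> bool" where
  "dual_integrable T K \<longleftrightarrow>
     (\<forall>v\<in>H1. (\<lambda>s. K s v) \<in> borel_measurable (lebesgue_on {0..T})) \<and>
     (\<exists>c. integrable (lebesgue_on {0..T}) c \<and>
        (AE s in lebesgue_on {0..T}. \<forall>v\<in>H1. \<bar>K s v\<bar> \<le> c s * H1_norm v))"

section \<open>Noise\<close>

definition filtered_probability_space :: "'a measure \<Rightarrow> (real \<Rightarrow> 'a measure) \<Rightarrow> bool" where
  "filtered_probability_space M F \<longleftrightarrow>
     prob_space M \<and> filtration (space M) F \<and> (\<forall>t. subalgebra M (F t))"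

text \<open>\<open>W t h\<close> is the (generalized) evaluation of the cylindrical process at time \<open>t\<close> in
  direction \<open>h\<close>.\<close>

definition cylindrical_wiener ::
  "real \<Rightarrow> 'a measure \<Rightarrow> (real \<Rightarrow> 'a measure) \<Rightarrow> (real \<Rightarrow> L2 \<Rightarrow> 'a \<Rightarrow> real) \<Rightarrow> bool" where
  "cylindrical_wiener T M F W \<longleftrightarrow>
     (\<forall>t\<in>{0..T}. \<forall>a b h k.
        AE \<omega> in M. W t (a *\<^sub>R h + b *\<^sub>R k) \<omega> = a * W t h \<omega> + b * W t k \<omega>) \<and>
     (\<forall>h. (AE \<omega> in M. W 0 h \<omega> = 0) \<and>
        (AE \<omega> in M. continuous_on {0..T} (\<lambda>t. W t h \<omega>)) \<and>
        (\<forall>t\<in>{0..T}. W t h \<in> borel_measurable (F t)) \<and>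
        (\<forall>s t. 0 \<le> s \<and> s < t \<and> t \<le> T \<longrightarrow>
           prob_space.indep_set M (sets (F s))
             (sets (vimage_algebra (space M) (\<lambda>\<omega>. W t h \<omega> - W s h \<omega>) borel)) \<and>
           (h \<noteq> 0 \<longrightarrow>
             distributed M lborel (\<lambda>\<omega>. W t h \<omega> - W s h \<omega>)
               (\<lambda>x. ennreal (normal_density 0 (norm h * sqrt (t - s)) x)))))"

definition hilbert_schmidt :: "(L2 \<Rightarrow> L2) \<Rightarrow> bool" where
  "hilbert_schmidt \<sigma> \<longleftrightarrow> bounded_linear \<sigma> \<and> summable (\<lambda>k. (norm (\<sigma> (e_basis k)))\<^sup>2)"

text \<open>\<open>Z\<close> is a version with continuous paths of the stochastic integral
  of the constant Hilbert-Schmidt operator \<open>\<sigma>\<close>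
  against \<open>W\<close>, that is, of the sum over \<open>k\<close> of \<open>W t (e_basis k)\<close> times \<open>\<sigma> (e_basis k)\<close>, which
  converges in mean square.\<close>

definition stochastic_integral ::
  "real \<Rightarrow> 'a measure \<Rightarrow> (real \<Rightarrow> L2 \<Rightarrow> 'a \<Rightarrow> real) \<Rightarrow> (L2 \<Rightarrow> L2) \<Rightarrow> (real \<Rightarrow> 'a \<Rightarrow> L2) \<Rightarrow> bool" where
  "stochastic_integral T M W \<sigma> Z \<longleftrightarrow>
     (AE \<omega> in M. continuous_on {0..T} (\<lambda>t. Z t \<omega>)) \<and>
     (\<forall>t\<in>{0..T}. Z t \<in> borel_measurable M \<and>
        (\<lambda>N. \<integral>\<^sup>+ \<omega>. ennreal ((norm (Z t \<omega> - (\<Sum>k<N. W t (e_basis k) \<omega> *\<^sub>R \<sigma> (e_basis k))))\<^sup>2) \<partial>M)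
          \<longlonglongrightarrow> 0)"

section \<open>State equation\<close>

definition measurable_adapted ::
  "real \<Rightarrow> 'a measure \<Rightarrow> (real \<Rightarrow> 'a measure) \<Rightarrow> (real \<Rightarrow> 'a \<Rightarrow> L2) \<Rightarrow> bool" where
  "measurable_adapted T M F g \<longleftrightarrow>
     (\<lambda>(t, \<omega>). g t \<omega>) \<in> borel_measurable (lebesgue_on {0..T} \<Otimes>\<^sub>M M) \<and>
     (\<forall>t\<in>{0..T}. g t \<in> borel_measurable (F t))"

definition control_space ::
  "real \<Rightarrow> 'a measure \<Rightarrow> (real \<Rightarrow> 'a measure) \<Rightarrow> (real \<Rightarrow> 'a \<Rightarrow> L2) set" where
  "control_space T M F =
     {g. measurable_adapted T M F g \<and>
         integrable (lebesgue_on {0..T} \<Otimes>\<^sub>M M) (\<lambda>(t, \<omega>). (norm (g t \<omega>))\<^sup>2)}"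

definition drift :: "(real \<Rightarrow> real) \<Rightarrow> L2 \<Rightarrow> L2 \<Rightarrow> L2 \<Rightarrow> real" where
  "drift f u g v = neumann_laplacian u v + nemytskii_dual f u v + inner g v"

text \<open>Strong (variational) solution for a given control process \<open>g\<close>: an adapted process
  whose paths almost surely are continuous into \<^typ>\<open>L2\<close> and square-integrable into \<^const>\<open>H1\<close>,
  and for which the integrated equation holds as an identity in the dual of \<^const>\<open>H1\<close>.\<close>

definition solves_with_control ::
  "real \<Rightarrow> 'a measure \<Rightarrow> (real \<Rightarrow> 'a measure) \<Rightarrow> (real \<Rightarrow> L2 \<Rightarrow> 'a \<Rightarrow> real) \<Rightarrow> (L2 \<Rightarrow> L2) \<Rightarrow>
   (real \<Rightarrow> real) \<Rightarrow> L2 \<Rightarrow> (real \<Rightarrow> 'a \<Rightarrow> L2) \<Rightarrow> (real \<Rightarrow> 'a \<Rightarrow> L2) \<Rightarrow> bool" where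
  "solves_with_control T M F W \<sigma> f u0 g u \<longleftrightarrow>
     measurable_adapted T M F u \<and>
     (\<exists>Z. stochastic_integral T M W \<sigma> Z \<and>
       (AE \<omega> in M.
          continuous_on {0..T} (\<lambda>t. u t \<omega>) \<and>
          (AE s in lebesgue_on {0..T}. u s \<omega> \<in> H1 \<and>
             (\<forall>v\<in>H1. integrable Lam (\<lambda>x. nemytskii f (u s \<omega>) x * rep_L2 v x))) \<and>
          integrable (lebesgue_on {0..T}) (\<lambda>s. (H1_norm (u s \<omega>))\<^sup>2) \<and>
          dual_integrable T (\<lambda>s. drift f (u s \<omega>) (g s \<omega>)) \<and>
          (\<forall>t\<in>{0..T}. \<forall>v\<in>H1.
             inner (u t \<omega>) v =
               inner u0 v + (\<integral>s. drift f (u s \<omega>) (g s \<omega>) v \<partial>lebesgue_on {0..t})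
               + inner (Z t \<omega>) v)))"

definition solves_with_feedback ::
  "real \<Rightarrow> 'a measure \<Rightarrow> (real \<Rightarrow> 'a measure) \<Rightarrow> (real \<Rightarrow> L2 \<Rightarrow> 'a \<Rightarrow> real) \<Rightarrow> (L2 \<Rightarrow> L2) \<Rightarrow>
   (real \<Rightarrow> real) \<Rightarrow> L2 \<Rightarrow> (real \<Rightarrow> L2 \<Rightarrow> L2) \<Rightarrow> (real \<Rightarrow> 'a \<Rightarrow> L2) \<Rightarrow> bool" where
  "solves_with_feedback T M F W \<sigma> f u0 G u \<longleftrightarrow>
     solves_with_control T M F W \<sigma> f u0 (\<lambda>t \<omega>. G t (u t \<omega>)) u"

text \<open>Uniqueness of solutions is understood up to indistinguishability.\<close>

definition unique_solution ::
  "real \<Rightarrow> 'a measure \<Rightarrow> (real \<Rightarrow> 'a measure) \<Rightarrow> (real \<Rightarrow> L2 \<Rightarrow> 'a \<Rightarrow> real) \<Rightarrow> (L2 \<Rightarrow> L2) \<Rightarrow>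
   (real \<Rightarrow> real) \<Rightarrow> L2 \<Rightarrow> (real \<Rightarrow> L2 \<Rightarrow> L2) \<Rightarrow> (real \<Rightarrow> 'a \<Rightarrow> L2) \<Rightarrow> bool" where
  "unique_solution T M F W \<sigma> f u0 G u \<longleftrightarrow>
     solves_with_feedback T M F W \<sigma> f u0 G u \<and>
     (\<forall>u'. solves_with_feedback T M F W \<sigma> f u0 G u' \<longrightarrow>
        (AE \<omega> in M. \<forall>t\<in>{0..T}. u' t \<omega> = u t \<omega>))"

definition standing_assumption ::
  "real \<Rightarrow> 'a measure \<Rightarrow> (real \<Rightarrow> 'a measure) \<Rightarrow> (real \<Rightarrow> L2 \<Rightarrow> 'a \<Rightarrow> real) \<Rightarrow> (L2 \<Rightarrow> L2) \<Rightarrow>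
   (real \<Rightarrow> real) \<Rightarrow> L2 \<Rightarrow> bool" where
  "standing_assumption T M F W \<sigma> f u0 \<longleftrightarrow>
     (\<forall>G. continuous_on ({0..T} \<times> UNIV) (\<lambda>(t, u). G t u) \<and>
          (\<exists>L. \<forall>t\<in>{0..T}. L-lipschitz_on UNIV (G t)) \<longrightarrow>
        (\<exists>u. unique_solution T M F W \<sigma> f u0 G u \<and> u \<in> control_space T M F))"

text \<open>Here and below, feedbacks \<open>[0, T] \<times> L2 \<rightarrow> L2\<close> are total functions whose values at times
  outside \<open>[0, T]\<close> play no role.\<close>

definition U_ad ::
  "real \<Rightarrow> 'a measure \<Rightarrow> (real \<Rightarrow> 'a measure) \<Rightarrow> (real \<Rightarrow> L2 \<Rightarrow> 'a \<Rightarrow> real) \<Rightarrow> (L2 \<Rightarrow> L2) \<Rightarrow>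
   (real \<Rightarrow> real) \<Rightarrow> L2 \<Rightarrow> (real \<Rightarrow> L2 \<Rightarrow> L2) set" where
  "U_ad T M F W \<sigma> f u0 =
     {G. \<exists>u. unique_solution T M F W \<sigma> f u0 G u \<and> (\<lambda>t \<omega>. G t (u t \<omega>)) \<in> control_space T M F}"

section \<open>Optimal feedback\<close>

definition locally_lipschitz :: "(real \<Rightarrow> real) \<Rightarrow> bool" where
  "locally_lipschitz h \<longleftrightarrow> (\<forall>y. \<exists>\<epsilon>>0. \<exists>L. L-lipschitz_on (cball y \<epsilon>) h)"

definition cost_rate ::
  "(real \<Rightarrow> real \<Rightarrow> real \<Rightarrow> real) \<Rightarrow> real \<Rightarrow> real \<Rightarrow> L2 \<Rightarrow> L2 \<Rightarrow> real" where
  "cost_rate l \<nu> t u g = (\<integral>x. l t x (rep_L2 u x) \<partial>Lam) + \<nu> / 2 * (norm g)\<^sup>2"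

definition path_cost ::
  "real \<Rightarrow> (real \<Rightarrow> real \<Rightarrow> real \<Rightarrow> real) \<Rightarrow> (real \<Rightarrow> real \<Rightarrow> real) \<Rightarrow> real \<Rightarrow>
   (real \<Rightarrow> L2) \<Rightarrow> (real \<Rightarrow> L2) \<Rightarrow> real" where
  "path_cost T l m \<nu> g u =
     (\<integral>t. cost_rate l \<nu> t (u t) (g t) \<partial>lebesgue_on {0..T}) + (\<integral>x. m x (rep_L2 (u T) x) \<partial>Lam)"

definition J_cost ::
  "real \<Rightarrow> 'a measure \<Rightarrow> (real \<Rightarrow> real \<Rightarrow> real \<Rightarrow> real) \<Rightarrow> (real \<Rightarrow> real \<Rightarrow> real) \<Rightarrow> real \<Rightarrow>
   (real \<Rightarrow> 'a \<Rightarrow> L2) \<Rightarrow> (real \<Rightarrow> 'a \<Rightarrow> L2) \<Rightarrow> real" where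
  "J_cost T M l m \<nu> g u = (\<integral>\<omega>. path_cost T l m \<nu> (\<lambda>t. g t \<omega>) (\<lambda>t. u t \<omega>) \<partial>M)"

text \<open>The library integral of a non-integrable function is \<open>0\<close>, so \<^const>\<open>J_cost\<close> is only
  meaningful where all iterated integrals exist.\<close>

definition J_defined ::
  "real \<Rightarrow> 'a measure \<Rightarrow> (real \<Rightarrow> real \<Rightarrow> real \<Rightarrow> real) \<Rightarrow> (real \<Rightarrow> real \<Rightarrow> real) \<Rightarrow> real \<Rightarrow>
   (real \<Rightarrow> 'a \<Rightarrow> L2) \<Rightarrow> (real \<Rightarrow> 'a \<Rightarrow> L2) \<Rightarrow> bool" where
  "J_defined T M l m \<nu> g u \<longleftrightarrow>
     (AE \<omega> in M.
        (AE t in lebesgue_on {0..T}. integrable Lam (\<lambda>x. l t x (rep_L2 (u t \<omega>) x))) \<and>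
        integrable (lebesgue_on {0..T}) (\<lambda>t. cost_rate l \<nu> t (u t \<omega>) (g t \<omega>)) \<and>
        integrable Lam (\<lambda>x. m x (rep_L2 (u T \<omega>) x))) \<and>
     integrable M (\<lambda>\<omega>. path_cost T l m \<nu> (\<lambda>t. g t \<omega>) (\<lambda>t. u t \<omega>))"

text \<open>The minimization runs over the controls for which the state and a finite cost exist.\<close>

definition optimal_feedback ::
  "real \<Rightarrow> 'a measure \<Rightarrow> (real \<Rightarrow> 'a measure) \<Rightarrow> (real \<Rightarrow> L2 \<Rightarrow> 'a \<Rightarrow> real) \<Rightarrow> (L2 \<Rightarrow> L2) \<Rightarrow>
   (real \<Rightarrow> real) \<Rightarrow> L2 \<Rightarrow> (real \<Rightarrow> real \<Rightarrow> real \<Rightarrow> real) \<Rightarrow> (real \<Rightarrow> real \<Rightarrow> real) \<Rightarrow> real \<Rightarrow>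
   (real \<Rightarrow> L2 \<Rightarrow> L2) \<Rightarrow> bool" where
  "optimal_feedback T M F W \<sigma> f u0 l m \<nu> G \<longleftrightarrow>
     (\<exists>u. unique_solution T M F W \<sigma> f u0 G u \<and>
        (\<lambda>t \<omega>. G t (u t \<omega>)) \<in> control_space T M F \<and>
        J_defined T M l m \<nu> (\<lambda>t \<omega>. G t (u t \<omega>)) u \<and>
        (\<forall>g\<in>control_space T M F. \<forall>v.
           solves_with_control T M F W \<sigma> f u0 g v \<and> J_defined T M l m \<nu> g v \<longrightarrow>
           J_cost T M l m \<nu> (\<lambda>t \<omega>. G t (u t \<omega>)) u \<le> J_cost T M l m \<nu> g v))"

section \<open>Uniform approximation property\<close>

definition uniform_approximation_property ::
  "real \<Rightarrow> (real \<Rightarrow> L2 \<Rightarrow> L2) set \<Rightarrow> (real \<Rightarrow> L2 \<Rightarrow> L2) \<Rightarrow> bool" where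
  "uniform_approximation_property T U G \<longleftrightarrow>
     (\<exists>H :: nat \<Rightarrow> nat \<Rightarrow> real \<Rightarrow> L2 \<Rightarrow> L2.
        (\<forall>n m. H n m \<in> U) \<and>
        (\<forall>n. \<exists>C>0. \<forall>m. \<forall>t\<in>{0..T}. \<forall>u. norm (H n m t u) \<le> C * (1 + norm u)) \<and>
        (\<forall>R>0. \<forall>n.
           (\<lambda>m. SUP (t, u)\<in>{0..T} \<times> {u. norm u \<le> R}.
                  ennreal ((norm (finitely_based G n t u - H n m t u))\<^sup>2)) \<longlonglongrightarrow> 0))"

section \<open>Neural networks\<close>

definition networks :: "(real \<Rightarrow> real) \<Rightarrow> nat \<Rightarrow> nat \<Rightarrow> (real \<Rightarrow> real vec \<Rightarrow> real vec) set" where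
  "networks \<theta> n k =
     {\<lambda>t x. B *\<^sub>v map_vec \<theta> (A *\<^sub>v vCons t x + a) | A a B.
        A \<in> carrier_mat k (n + 2) \<and> a \<in> carrier_vec k \<and> B \<in> carrier_mat (n + 1) k}"

definition all_networks :: "(real \<Rightarrow> real) \<Rightarrow> nat \<Rightarrow> (real \<Rightarrow> real vec \<Rightarrow> real vec) set" where
  "all_networks \<theta> n = (\<Union>k\<in>{1..}. networks \<theta> n k)"

definition euclidean_norm :: "real vec \<Rightarrow> real" where
  "euclidean_norm x = sqrt (\<Sum>i<dim_vec x. (vec_index x i)\<^sup>2)"

definition cutoff :: "nat \<Rightarrow> real vec \<Rightarrow> real vec" where
  "cutoff l x = (if euclidean_norm x \<le> real l then x else (real l / euclidean_norm x) \<cdot>\<^sub>v x)"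

definition coordinates :: "nat \<Rightarrow> L2 \<Rightarrow> real vec" where
  "coordinates n u = vec (n + 1) (\<lambda>i. inner u (e_basis i))"

definition network_feedbacks :: "real \<Rightarrow> (real \<Rightarrow> real) \<Rightarrow> (real \<Rightarrow> L2 \<Rightarrow> L2) set" where
  "network_feedbacks T \<theta> =
     {G. \<exists>n l. \<exists>\<psi>\<in>all_networks \<theta> n. 1 \<le> l \<and>
        (\<forall>t\<in>{0..T}. \<forall>u.
           G t u = (\<Sum>i\<le>n. vec_index (\<psi> t (cutoff l (coordinates n u))) i *\<^sub>R e_basis i))}"

end

theory Submission
  imports Defs
begin

text \<open>
  A one-layer network evaluated at the time and the first \<open>n + 1\<close> Fourier coefficients is, in each
  output component, a sum of terms \<open>c * \<theta> (inner w x + b)\<close> with \<open>x\<close> in the inner product space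
  \<open>real \<times> L2\<close>, and the cutoff of the coefficients is a radial retraction composed with \<open>P_proj n\<close>. In
  this form both claims are statements about Lipschitz maps and about uniform approximation
  on compact sets.

  Membership in \<open>U_ad\<close>: since \<open>\<theta>\<close>, the projection and the radial retraction are Lipschitz, every network
  feedback is Lipschitz jointly in time and state (\<open>lipschitz_ridge_feedback\<close>). The standing assumption then
  provides the unique square-integrable solution, and the control inherits measurability and
  square integrability from it (\<open>ridge_feedback_in_control_space\<close>).

  Approximation: for continuous \<open>G\<close>, the coefficients of \<open>G t v\<close> are continuous on \<open>{0..T}\<close> times a compact
  set of the span of the first basis elements. So everything rests on the universal approximation theorem
  for continuous non-polynomial activations (\<open>universal_approximation\<close>), proved as follows.
  If \<open>x ^ j * f (c * x + b)\<close> is a limit of networks for all \<open>c\<close> and \<open>b\<close>, then so is the same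
  expression with \<open>f\<close> replaced by a moving average of \<open>f\<close>, and differentiating it in \<open>c\<close> yields
  \<open>x ^ (j + 1)\<close> times a forward difference of \<open>f\<close>. Starting from \<open>\<theta>\<close> and ending with \<open>c = 0\<close>, the
  monomial \<open>x ^ k\<close> is obtained unless all differences of \<open>\<theta>\<close> of order \<open>k\<close> vanish, which would make \<open>\<theta>\<close> a
  polynomial (\<open>polynomial_if_differences_vanish\<close>). Hence networks approximate every continuous function of
  one variable, in particular \<open>exp\<close>; and exponential networks are dense in several
  variables by the Stone-Weierstrass theorem (\<open>approximable_exp\<close>).
\<close>

section \<open>Ridge sums and uniform approximation\<close>

text \<open>A shallow network with one real output, written without coordinates so that the inputs may range
  over any real inner product space. The entries of the list are the hidden units: outer weight,
  inner weight and bias.\<close>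

definition ridge_sum :: "(real \<Rightarrow> real) \<Rightarrow> (real \<times> 'a \<times> real) list \<Rightarrow> 'a::real_inner \<Rightarrow> real" where
  "ridge_sum \<theta> L x = (\<Sum>(c, w, b)\<leftarrow>L. c * \<theta> (inner w x + b))"

definition approximable :: "(real \<Rightarrow> real) \<Rightarrow> 'a::real_inner set \<Rightarrow> ('a \<Rightarrow> real) \<Rightarrow> bool" where
  "approximable \<theta> K g \<longleftrightarrow> (\<forall>\<epsilon>>0. \<exists>L. \<forall>x\<in>K. \<bar>g x - ridge_sum \<theta> L x\<bar> \<le> \<epsilon>)"

lemma ridge_sum_Nil [simp]: "ridge_sum \<theta> [] x = 0"
  and ridge_sum_Cons [simp]:
    "ridge_sum \<theta> ((c, w, b) # L) x = c * \<theta> (inner w x + b) + ridge_sum \<theta> L x"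
  and ridge_sum_append [simp]:
    "ridge_sum \<theta> (L @ L') x = ridge_sum \<theta> L x + ridge_sum \<theta> L' x"
  by (simp_all add: ridge_sum_def)

lemma ridge_sum_cmult:
  "c * ridge_sum \<theta> L x = ridge_sum \<theta> (map (\<lambda>(d, w, b). (c * d, w, b)) L) x"
  by (induction L) (auto simp: distrib_left)

lemma approximable_ridge_sum: "approximable \<theta> K (ridge_sum \<theta> L)"
  unfolding approximable_def by (intro allI impI exI[of _ L]) auto

lemma approximable_cong:
  assumes "approximable \<theta> K f" "\<And>x. x \<in> K \<Longrightarrow> g x = f x"
  shows "approximable \<theta> K g"
  using assms by (simp add: approximable_def)

lemma approximable_zero: "approximable \<theta> K (\<lambda>x. 0)"
  by (rule approximable_cong[OF approximable_ridge_sum[of _ _ "[]"]]) simp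

lemma approximable_add:
  assumes "approximable \<theta> K f" "approximable \<theta> K g"
  shows "approximable \<theta> K (\<lambda>x. f x + g x)"
  unfolding approximable_def
proof (intro allI impI)
  fix \<epsilon> :: real assume "\<epsilon> > 0"
  then have "\<epsilon> / 2 > 0" by simp
  then obtain L L' where
    "\<forall>x\<in>K. \<bar>f x - ridge_sum \<theta> L x\<bar> \<le> \<epsilon> / 2" "\<forall>x\<in>K. \<bar>g x - ridge_sum \<theta> L' x\<bar> \<le> \<epsilon> / 2"
    using assms unfolding approximable_def by meson
  then have "\<forall>x\<in>K. \<bar>f x + g x - ridge_sum \<theta> (L @ L') x\<bar> \<le> \<epsilon>"
    by (smt (verit) ridge_sum_append field_sum_of_halves)
  then show "\<exists>L. \<forall>x\<in>K. \<bar>f x + g x - ridge_sum \<theta> L x\<bar> \<le> \<epsilon>" by blast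
qed

lemma approximable_cmult:
  assumes "approximable \<theta> K f"
  shows "approximable \<theta> K (\<lambda>x. c * f x)"
  unfolding approximable_def
proof (intro allI impI)
  fix \<epsilon> :: real assume e: "\<epsilon> > 0"
  define d where "d = \<epsilon> / (\<bar>c\<bar> + 1)"
  have "d > 0" using e by (simp add: d_def add_nonneg_pos)
  then obtain L where L: "\<forall>x\<in>K. \<bar>f x - ridge_sum \<theta> L x\<bar> \<le> d"
    using assms unfolding approximable_def by meson
  have "\<bar>c * f x - c * ridge_sum \<theta> L x\<bar> \<le> \<epsilon>" if "x \<in> K" for x
  proof -
    have "\<bar>c * f x - c * ridge_sum \<theta> L x\<bar> = \<bar>c\<bar> * \<bar>f x - ridge_sum \<theta> L x\<bar>"
      by (simp add: abs_mult right_diff_distrib flip: abs_mult)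
    also have "\<dots> \<le> (\<bar>c\<bar> + 1) * d"
      using L that \<open>d > 0\<close> by (intro mult_mono) auto
    also have "\<dots> = \<epsilon>" by (simp add: d_def)
    finally show ?thesis .
  qed
  then show "\<exists>L. \<forall>x\<in>K. \<bar>c * f x - ridge_sum \<theta> L x\<bar> \<le> \<epsilon>"
    unfolding ridge_sum_cmult by blast
qed

lemma approximable_sum:
  assumes "\<And>i. i \<in> I \<Longrightarrow> approximable \<theta> K (f i)"
  shows "approximable \<theta> K (\<lambda>x. \<Sum>i\<in>I. f i x)"
  using assms
  by (induction I rule: infinite_finite_induct) (auto intro: approximable_zero approximable_add)

lemma approximable_limit:
  assumes "\<And>\<epsilon>. \<epsilon> > 0 \<Longrightarrow> \<exists>g. approximable \<theta> K g \<and> (\<forall>x\<in>K. \<bar>f x - g x\<bar> \<le> \<epsilon>)"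
  shows "approximable \<theta> K f"
  unfolding approximable_def
proof (intro allI impI)
  fix \<epsilon> :: real assume "\<epsilon> > 0"
  then have e: "\<epsilon> / 2 > 0" by simp
  obtain g where g: "approximable \<theta> K g" "\<forall>x\<in>K. \<bar>f x - g x\<bar> \<le> \<epsilon> / 2"
    using assms[OF e] by blast
  obtain L where "\<forall>x\<in>K. \<bar>g x - ridge_sum \<theta> L x\<bar> \<le> \<epsilon> / 2"
    using g(1) e unfolding approximable_def by meson
  with g(2) have "\<forall>x\<in>K. \<bar>f x - ridge_sum \<theta> L x\<bar> \<le> \<epsilon>"
    by (smt (verit) field_sum_of_halves)
  then show "\<exists>L. \<forall>x\<in>K. \<bar>f x - ridge_sum \<theta> L x\<bar> \<le> \<epsilon>" by blast
qed

lemma approximable_affine: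
  fixes K :: "'a::real_inner set"
  assumes g: "approximable \<theta> S g" and S: "\<And>x. x \<in> K \<Longrightarrow> inner w x + b \<in> S"
  shows "approximable \<theta> K (\<lambda>x. g (inner w x + b))"
proof -
  have *: "ridge_sum \<theta> L (inner w x + b) =
      ridge_sum \<theta> (map (\<lambda>(c, a, d). (c, a *\<^sub>R w, a * b + d)) L) x" for L x
    by (induction L) (auto simp: algebra_simps)
  show ?thesis
    unfolding approximable_def
  proof (intro allI impI)
    fix \<epsilon> :: real assume "\<epsilon> > 0"
    then obtain L where "\<forall>y\<in>S. \<bar>g y - ridge_sum \<theta> L y\<bar> \<le> \<epsilon>"
      using g unfolding approximable_def by blast
    then have "\<forall>x\<in>K. \<bar>g (inner w x + b) - ridge_sum \<theta> L (inner w x + b)\<bar> \<le> \<epsilon>"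
      using S by blast
    then show "\<exists>L. \<forall>x\<in>K. \<bar>g (inner w x + b) - ridge_sum \<theta> L x\<bar> \<le> \<epsilon>"
      unfolding * by blast
  qed
qed

text \<open>If \<open>\<rho>\<close> can itself be approximated by \<open>\<theta>\<close>-networks on bounded intervals, each hidden unit of a
  \<open>\<rho>\<close>-network can be replaced by a small \<open>\<theta>\<close>-network. This lets the density question be settled for the
  convenient activation \<^const>\<open>exp\<close> and transferred to \<open>\<theta>\<close> through functions of one variable.\<close>

lemma approximable_trans:
  fixes K :: "'a::real_inner set"
  assumes f: "approximable \<rho> K f" and "bounded K"
    and \<rho>: "\<And>R. approximable \<theta> {-R..R} \<rho>"
  shows "approximable \<theta> K f"
proof (rule approximable_limit)
  fix \<epsilon> :: real assume "\<epsilon> > 0"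
  then obtain L where L: "\<forall>x\<in>K. \<bar>f x - ridge_sum \<rho> L x\<bar> \<le> \<epsilon>"
    using f unfolding approximable_def by blast
  obtain B where B: "\<And>x. x \<in> K \<Longrightarrow> norm x \<le> B"
    using \<open>bounded K\<close> by (auto simp: bounded_iff)
  have "approximable \<theta> K (ridge_sum \<rho> L)"
  proof (induction L)
    case Nil
    show ?case using approximable_zero by (simp add: approximable_def)
  next
    case (Cons a L)
    obtain c w b where a: "a = (c, w, b)" by (cases a)
    have "inner w x + b \<in> {-(norm w * B + \<bar>b\<bar>)..norm w * B + \<bar>b\<bar>}" if "x \<in> K" for x
    proof -
      have "\<bar>inner w x\<bar> \<le> norm w * norm x" by (rule Cauchy_Schwarz_ineq2)
      also have "\<dots> \<le> norm w * B" using B[OF that] by (simp add: mult_left_mono)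
      finally show ?thesis by auto
    qed
    then have "approximable \<theta> K (\<lambda>x. c * \<rho> (inner w x + b) + ridge_sum \<rho> L x)"
      by (intro approximable_add approximable_cmult Cons.IH approximable_affine[OF \<rho>])
    then show ?case by (rule approximable_cong) (simp add: a)
  qed
  with L show "\<exists>g. approximable \<theta> K g \<and> (\<forall>x\<in>K. \<bar>f x - g x\<bar> \<le> \<epsilon>)" by blast
qed

section \<open>Finite differences and polynomials\<close>

definition forward_diff :: "real \<Rightarrow> (real \<Rightarrow> real) \<Rightarrow> real \<Rightarrow> real" where
  "forward_diff h f x = f (x + h) - f x"

text \<open>Newton's forward difference formula: it turns vanishing differences of order \<open>k\<close> into a
  polynomial of degree below \<open>k\<close> on every grid.\<close>

lemma newton_forward:
  "f (x + real j * h) = (\<Sum>i\<le>j. real (j choose i) * (forward_diff h ^^ i) f x)"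
proof (induction j arbitrary: f)
  case 0
  then show ?case by simp
next
  case (Suc j)
  let ?D = "\<lambda>i. (forward_diff h ^^ i) f x"
  have "f (x + real (Suc j) * h) = f (x + real j * h) + forward_diff h f (x + real j * h)"
    by (simp add: forward_diff_def algebra_simps)
  also have "\<dots> = (\<Sum>i\<le>j. real (j choose i) * ?D i) + (\<Sum>i\<le>j. real (j choose i) * ?D (Suc i))"
    unfolding Suc.IH by (simp add: funpow_swap1)
  also have "(\<Sum>i\<le>j. real (j choose i) * ?D i) = (\<Sum>i\<le>Suc j. real (j choose i) * ?D i)"
    by simp
  also have "\<dots> = ?D 0 + (\<Sum>i\<le>j. real (j choose Suc i) * ?D (Suc i))"
    by (subst sum.atMost_Suc_shift) simp
  also have "\<dots> + (\<Sum>i\<le>j. real (j choose i) * ?D (Suc i)) =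
      ?D 0 + (\<Sum>i\<le>j. real (Suc j choose Suc i) * ?D (Suc i))"
    by (simp add: sum.distrib distrib_right)
  also have "\<dots> = (\<Sum>i\<le>Suc j. real (Suc j choose i) * ?D i)"
    by (subst sum.atMost_Suc_shift) simp
  finally show ?case .
qed

lemma poly_gbinomial_linear: "\<exists>p. \<forall>y::real. poly p y = (c * y gchoose i)"
proof (intro exI allI)
  fix y
  show "poly (Polynomial.smult (1 / fact i) (\<Prod>j = 0..<i. [:- real j, c:])) y = (c * y gchoose i)"
    by (simp add: gbinomial_prod_rev poly_prod algebra_simps)
qed

lemma polynomial_on_grid:
  assumes D: "\<And>x. (forward_diff (1 / real N) ^^ k) f x = 0" and "N > 0"
  shows "\<exists>p. \<forall>j::nat. f (x + real j / real N) = poly p (real j / real N)"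
proof -
  define h where "h = 1 / real N"
  have D0: "(forward_diff h ^^ i) f = (\<lambda>x. 0)" if "i \<ge> k" for i
    using that D by (induction i rule: dec_induct) (auto simp: h_def fun_eq_iff forward_diff_def)
  have "\<forall>i. \<exists>p. \<forall>y::real. poly p y = (real N * y gchoose i)"
    by (intro allI poly_gbinomial_linear)
  then obtain p where p: "\<And>i y. poly (p i) y = (real N * y gchoose i)"
    by metis
  define q where "q = (\<Sum>i<k. Polynomial.smult ((forward_diff h ^^ i) f x) (p i))"
  have "f (x + real j / real N) = poly q (real j / real N)" for j :: nat
  proof -
    have "f (x + real j / real N) = (\<Sum>i\<le>j. real (j choose i) * (forward_diff h ^^ i) f x)"
      using newton_forward[of f x j h] by (simp add: h_def)
    also have "\<dots> = (\<Sum>i<max (Suc j) k. real (j choose i) * (forward_diff h ^^ i) f x)"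
      by (intro sum.mono_neutral_left) auto
    also have "\<dots> = (\<Sum>i<k. real (j choose i) * (forward_diff h ^^ i) f x)"
      by (intro sum.mono_neutral_right) (auto simp: D0)
    also have "\<dots> = poly q (real j / real N)"
      using \<open>N > 0\<close> by (simp add: q_def poly_sum p binomial_gbinomial mult.commute)
    finally show ?thesis .
  qed
  then show ?thesis by blast
qed

lemma poly_eq_if_agree_on_naturals:
  fixes p q :: "real poly"
  assumes "\<And>j::nat. poly p (real j) = poly q (real j)"
  shows "p = q"
proof (rule ccontr)
  assume "p \<noteq> q"
  then have "finite {x. poly (p - q) x = 0}" by (intro poly_roots_finite) simp
  moreover have "range real \<subseteq> {x. poly (p - q) x = 0}" using assms by auto
  ultimately have "finite (range real)" by (rule rev_finite_subset)
  then show False by (simp add: finite_image_iff inj_on_def)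
qed

text \<open>Frechet's characterization of polynomials. The polynomials obtained on the grids of mesh
  \<open>1 / N\<close> that start at a common point agree on the infinitely many integer points, hence are one
  polynomial, which by continuity equals \<open>f\<close> on a half-line. Half-lines with different end points
  overlap, so these polynomials again coincide.\<close>

lemma polynomial_if_differences_vanish:
  fixes f :: "real \<Rightarrow> real"
  assumes cont: "continuous_on UNIV f"
    and D: "\<And>h x. h > 0 \<Longrightarrow> (forward_diff h ^^ k) f x = 0"
  shows "\<exists>p. \<forall>x. f x = poly p x"
proof -
  \<comment> \<open>Grids extend to the right only, so each starting point first yields a half-line.\<close>
  have half: "\<exists>p. \<forall>y\<ge>0. f (x + y) = poly p y" for x
  proof -
    have "\<exists>p. \<forall>j::nat. f (x + real j / real N) = poly p (real j / real N)" if "N > 0" for N :: nat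
      using that D by (intro polynomial_on_grid[where k = k]) auto
    then obtain p where
      p: "\<And>N j. N > 0 \<Longrightarrow> f (x + real j / real N) = poly (p N) (real j / real N)"
      by metis
    have same: "p N = p 1" if N: "N > 0" for N :: nat
    proof (rule poly_eq_if_agree_on_naturals)
      fix j :: nat
      show "poly (p N) (real j) = poly (p 1) (real j)"
        using p[OF N, of "j * N"] p[of 1 j] N by simp
    qed
    define S where "S = {y. f (x + y) = poly (p 1) y}"
    have "closed S"
      unfolding S_def
      by (intro closed_Collect_eq continuous_intros continuous_on_compose2[OF cont]) auto
    have "y \<in> S" if "y \<ge> 0" for y
    proof -
      define r where "r n = real (nat \<lfloor>y * real (Suc n)\<rfloor>) / real (Suc n)" for n
      have "r n \<in> S" for n
        using p[of "Suc n" "nat \<lfloor>y * real (Suc n)\<rfloor>"] same[of "Suc n"]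
        by (simp add: S_def r_def)
      moreover have "r \<longlonglongrightarrow> y"
      proof (rule tendsto_sandwich)
        have r: "y - 1 / real (Suc n) \<le> r n \<and> r n \<le> y" for n
        proof -
          have "real (nat \<lfloor>y * real (Suc n)\<rfloor>) = real_of_int \<lfloor>y * real (Suc n)\<rfloor>"
            using that by simp
          moreover have "real_of_int \<lfloor>y * real (Suc n)\<rfloor> \<le> y * real (Suc n)"
            "y * real (Suc n) - 1 \<le> real_of_int \<lfloor>y * real (Suc n)\<rfloor>" by linarith+
          ultimately have "(y * real (Suc n) - 1) / real (Suc n) \<le> r n"
            "r n \<le> (y * real (Suc n)) / real (Suc n)"
            unfolding r_def by (metis divide_right_mono of_nat_0_le_iff)+
          then show ?thesis by (simp add: diff_divide_distrib del: of_nat_Suc)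
        qed
        show "\<forall>\<^sub>F n in sequentially. y - 1 / real (Suc n) \<le> r n" using r by simp
        show "\<forall>\<^sub>F n in sequentially. r n \<le> y" using r by simp
        show "(\<lambda>n. y - 1 / real (Suc n)) \<longlonglongrightarrow> y"
          using tendsto_diff[OF tendsto_const LIMSEQ_inverse_real_of_nat, of y]
          by (simp add: inverse_eq_divide)
      qed simp
      ultimately show ?thesis
        using \<open>closed S\<close> closed_sequentially by blast
    qed
    then show ?thesis unfolding S_def by blast
  qed
  obtain p where p: "\<And>y. y \<ge> 0 \<Longrightarrow> f y = poly p y"
    using half[of 0] by auto
  have "f x = poly p x" for x
  proof -
    obtain q where q: "\<And>y. y \<ge> 0 \<Longrightarrow> f (- \<bar>x\<bar> + y) = poly q y"
      using half by blast
    have "q = pcompose p [:- \<bar>x\<bar>, 1:] "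
    proof -
      have "pcompose q [:\<bar>x\<bar>, 1:] = p"
      proof (rule poly_eq_if_agree_on_naturals)
        fix j :: nat
        show "poly (pcompose q [:\<bar>x\<bar>, 1:]) (real j) = poly p (real j)"
          using q[of "\<bar>x\<bar> + real j"] p[of "real j"] by (simp add: poly_pcompose)
      qed
      then have "pcompose p [:- \<bar>x\<bar>, 1:] = pcompose (pcompose q [:\<bar>x\<bar>, 1:]) [:- \<bar>x\<bar>, 1:]"
        by simp
      also have "\<dots> = q"
        by (simp flip: pcompose_assoc add: pcompose_pCons)
      finally show ?thesis by simp
    qed
    then show ?thesis
      using q[of "x + \<bar>x\<bar>"] by (simp add: poly_pcompose)
  qed
  then show ?thesis by blast
qed

section \<open>Monomials as limits of networks\<close>

text \<open>A derivative that is continuous is attained uniformly on bounded sets; the two limits that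
  follow, a Riemann sum and a difference quotient, need this uniformity.\<close>

lemma uniformly_differentiable:
  fixes G g :: "real \<Rightarrow> real"
  assumes G: "\<And>x. (G has_real_derivative g x) (at x)" and g: "continuous_on UNIV g"
    and "\<epsilon> > 0"
  shows "\<exists>\<delta>>0. \<forall>y z. \<bar>y\<bar> \<le> Q \<and> \<bar>z - y\<bar> \<le> \<delta> \<longrightarrow> \<bar>G z - G y - (z - y) * g y\<bar> \<le> \<epsilon> * \<bar>z - y\<bar>"
proof -
  have "uniformly_continuous_on {-(Q + 1)..Q + 1} g"
    using g by (intro compact_uniformly_continuous) (auto intro: continuous_on_subset)
  then obtain \<delta>0 where "\<delta>0 > 0" and \<delta>0:
    "\<And>y z. y \<in> {-(Q + 1)..Q + 1} \<Longrightarrow> z \<in> {-(Q + 1)..Q + 1} \<Longrightarrow> dist z y < \<delta>0 \<Longrightarrow> dist (g z) (g y) < \<epsilon>"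
    unfolding uniformly_continuous_on_def using \<open>\<epsilon> > 0\<close> by metis
  define \<delta> where "\<delta> = min 1 (\<delta>0 / 2)"
  have "\<bar>G z - G y - (z - y) * g y\<bar> \<le> \<epsilon> * \<bar>z - y\<bar>" if yz: "\<bar>y\<bar> \<le> Q" "\<bar>z - y\<bar> \<le> \<delta>" for y z
  proof -
    have "\<exists>\<xi>. \<bar>\<xi> - y\<bar> \<le> \<bar>z - y\<bar> \<and> G z - G y = (z - y) * g \<xi>"
    proof (cases y z rule: linorder_cases)
      case less
      then obtain \<xi> where "y < \<xi>" "\<xi> < z" "G z - G y = (z - y) * g \<xi>"
        using MVT2[of y z G g] G by blast
      then show ?thesis by (intro exI[of _ \<xi>]) auto
    next
      case greater
      then obtain \<xi> where "z < \<xi>" "\<xi> < y" "G y - G z = (y - z) * g \<xi>"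
        using MVT2[of z y G g] G by blast
      then show ?thesis by (intro exI[of _ \<xi>]) (auto simp: algebra_simps)
    qed auto
    then obtain \<xi> where \<xi>: "\<bar>\<xi> - y\<bar> \<le> \<bar>z - y\<bar>" "G z - G y = (z - y) * g \<xi>" by blast
    have "\<bar>\<xi> - y\<bar> \<le> 1" "\<bar>\<xi> - y\<bar> < \<delta>0"
      using \<xi>(1) yz(2) \<open>\<delta>0 > 0\<close> by (auto simp: \<delta>_def)
    then have "dist (g \<xi>) (g y) < \<epsilon>"
      using yz(1) by (intro \<delta>0) (auto simp: dist_real_def)
    moreover have "G z - G y - (z - y) * g y = (z - y) * (g \<xi> - g y)"
      by (simp add: \<xi>(2) algebra_simps)
    ultimately show ?thesis
      using mult_left_mono[of "\<bar>g \<xi> - g y\<bar>" \<epsilon> "\<bar>z - y\<bar>"]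
      by (simp add: abs_mult dist_real_def mult.commute[of \<epsilon>])
  qed
  moreover have "\<delta> > 0" using \<open>\<delta>0 > 0\<close> by (simp add: \<delta>_def)
  ultimately show ?thesis by blast
qed

text \<open>The power \<open>x ^ j\<close> records how many derivatives with respect to the dilation parameter \<open>c\<close> have
  been taken: differentiating \<open>x ^ j * f (c * x + b)\<close> in \<open>c\<close> produces
  \<open>x ^ (j + 1) * f' (c * x + b)\<close>. Asking for all \<open>c\<close> and \<open>b\<close> makes the property stable under this
  operation and under averaging over \<open>b\<close>.\<close>

definition approximable_dilations :: "(real \<Rightarrow> real) \<Rightarrow> nat \<Rightarrow> (real \<Rightarrow> real) \<Rightarrow> bool" where
  "approximable_dilations \<theta> j f \<longleftrightarrow> continuous_on UNIV f \<and>
     (\<forall>c b R. approximable \<theta> {-R..R} (\<lambda>x. x ^ j * f (c * x + b)))"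

lemma continuous_has_antiderivative:
  fixes f :: "real \<Rightarrow> real"
  assumes "continuous_on UNIV f"
  shows "\<exists>F. \<forall>x. (F has_real_derivative f x) (at x)"
  using einterval_antiderivative[of "-\<infinity>" "\<infinity>" f] assms
  by (auto simp: continuous_on_eq_continuous_at has_real_derivative_iff_has_vector_derivative)

text \<open>The increment of an antiderivative \<open>F\<close> is the integral of \<open>f\<close> over a window of length \<open>h\<close>, hence a
  uniform limit of Riemann sums, each of which is a combination of translates of \<open>f\<close>.\<close>

lemma approximable_dilations_increment:
  assumes f: "approximable_dilations \<theta> j f" and "h > 0"
    and F: "\<And>x. (F has_real_derivative f x) (at x)"
  shows "approximable \<theta> {-R..R} (\<lambda>x. x ^ j * forward_diff h F (c * x + b))"
proof (rule approximable_limit)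
  fix \<epsilon> :: real assume "\<epsilon> > 0"
  \<comment> \<open>The factor \<open>1 + \<bar>R\<bar> ^ j\<close> absorbs the weight \<open>x ^ j\<close>, and \<open>h\<close> is the total length of the window.\<close>
  define \<epsilon>' where "\<epsilon>' = \<epsilon> / (h * (1 + \<bar>R\<bar> ^ j))"
  have pos: "h * (1 + \<bar>R\<bar> ^ j) > 0"
    using \<open>h > 0\<close> by (intro mult_pos_pos add_pos_nonneg) auto
  then have "\<epsilon>' > 0" using \<open>\<epsilon> > 0\<close> by (simp add: \<epsilon>'_def)
  define Q where "Q = \<bar>c\<bar> * \<bar>R\<bar> + \<bar>b\<bar> + h"
  obtain \<delta> where "\<delta> > 0" and \<delta>:
    "\<And>y z. \<bar>y\<bar> \<le> Q \<Longrightarrow> \<bar>z - y\<bar> \<le> \<delta> \<Longrightarrow> \<bar>F z - F y - (z - y) * f y\<bar> \<le> \<epsilon>' * \<bar>z - y\<bar>"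
    using uniformly_differentiable[OF F _ \<open>\<epsilon>' > 0\<close>, of Q] f
    unfolding approximable_dilations_def by blast
  obtain N :: nat where N: "h / \<delta> < real N" using reals_Archimedean2 by blast
  moreover have "h / \<delta> > 0" using \<open>h > 0\<close> \<open>\<delta> > 0\<close> by simp
  ultimately have "N > 0" by (metis of_nat_0_less_iff less_trans)
  define s where "s = h / real N"
  have s: "s > 0" "s \<le> \<delta>" "real N * s = h"
    using N \<open>h > 0\<close> \<open>N > 0\<close> \<open>\<delta> > 0\<close> by (simp_all add: s_def field_simps)
  define g where "g x = (\<Sum>i<N. s * (x ^ j * f (c * x + (b + real i * s))))" for x
  have "approximable \<theta> {-R..R} g"
    unfolding g_def using f
    by (intro approximable_sum approximable_cmult) (simp add: approximable_dilations_def)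
  moreover have "\<bar>x ^ j * forward_diff h F (c * x + b) - g x\<bar> \<le> \<epsilon>" if x: "x \<in> {-R..R}" for x
  proof -
    have xR: "\<bar>x\<bar> \<le> \<bar>R\<bar>" using x by auto
    define y where "y i = c * x + b + real i * s" for i
    have "\<bar>c * x\<bar> \<le> \<bar>c\<bar> * \<bar>R\<bar>" using xR by (simp add: abs_mult mult_left_mono)
    moreover have "real i * s \<le> h" if "i < N" for i
      using that s(1) mult_right_mono[of "real i" "real N" s] by (simp add: s(3))
    ultimately have y: "\<bar>y i\<bar> \<le> Q" if "i < N" for i
      using that s(1) unfolding y_def Q_def by (smt (verit) mult_nonneg_nonneg of_nat_0_le_iff)
    have step: "y (Suc i) - y i = s" for i by (simp add: y_def algebra_simps)
    have "forward_diff h F (c * x + b) = F (y N) - F (y 0)"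
      by (simp add: forward_diff_def y_def s(3))
    also have "\<dots> = (\<Sum>i<N. F (y (Suc i)) - F (y i))"
      by (rule sum_lessThan_telescope[symmetric])
    finally have "\<bar>forward_diff h F (c * x + b) - (\<Sum>i<N. s * f (y i))\<bar> =
        \<bar>\<Sum>i<N. F (y (Suc i)) - F (y i) - (y (Suc i) - y i) * f (y i)\<bar>"
      by (simp add: sum_subtractf step)
    also have "\<dots> \<le> (\<Sum>i<N. \<epsilon>' * \<bar>y (Suc i) - y i\<bar>)"
      using y s by (intro order_trans[OF sum_abs] sum_mono \<delta>) (auto simp: step)
    also have "\<dots> = \<epsilon>' * h"
      using s by (simp add: step)
    finally have *: "\<bar>forward_diff h F (c * x + b) - (\<Sum>i<N. s * f (y i))\<bar> \<le> \<epsilon>' * h" .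
    have "g x = x ^ j * (\<Sum>i<N. s * f (y i))"
      by (simp add: g_def y_def sum_distrib_left algebra_simps)
    then have "\<bar>x ^ j * forward_diff h F (c * x + b) - g x\<bar> =
        \<bar>x\<bar> ^ j * \<bar>forward_diff h F (c * x + b) - (\<Sum>i<N. s * f (y i))\<bar>"
      by (simp flip: power_abs abs_mult add: right_diff_distrib)
    also have "\<dots> \<le> (1 + \<bar>R\<bar> ^ j) * (\<epsilon>' * h)"
      using * xR power_mono[OF xR, of j] by (intro mult_mono) auto
    also have "\<dots> = (h * (1 + \<bar>R\<bar> ^ j)) * \<epsilon>'" by (simp only: ac_simps)
    also have "\<dots> = \<epsilon>"
      unfolding \<epsilon>'_def using pos
      by (metis less_irrefl nonzero_mult_div_cancel_left times_divide_eq_right)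
    finally show ?thesis .
  qed
  ultimately show "\<exists>g. approximable \<theta> {-R..R} g \<and>
      (\<forall>x\<in>{-R..R}. \<bar>x ^ j * forward_diff h F (c * x + b) - g x\<bar> \<le> \<epsilon>)" by blast
qed

text \<open>The derivative with respect to the dilation parameter is a uniform limit of difference quotients,
  and these are combinations of two dilations.\<close>

lemma approximable_dilations_deriv:
  assumes A: "\<And>c b. approximable \<theta> {-R..R} (\<lambda>x. x ^ j * A (c * x + b))"
    and deriv: "\<And>x. (A has_real_derivative a x) (at x)" and a: "continuous_on UNIV a"
  shows "approximable \<theta> {-R..R} (\<lambda>x. x ^ Suc j * a (c * x + b))"
proof (rule approximable_limit)
  fix \<epsilon> :: real assume "\<epsilon> > 0"
  define \<epsilon>' where "\<epsilon>' = \<epsilon> / (1 + \<bar>R\<bar> ^ Suc j)"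
  have pos: "1 + \<bar>R\<bar> ^ Suc j > 0" by (intro add_pos_nonneg) auto
  then have "\<epsilon>' > 0" using \<open>\<epsilon> > 0\<close> by (simp add: \<epsilon>'_def)
  obtain \<delta> where "\<delta> > 0" and \<delta>: "\<And>y z. \<bar>y\<bar> \<le> \<bar>c\<bar> * \<bar>R\<bar> + \<bar>b\<bar> \<Longrightarrow> \<bar>z - y\<bar> \<le> \<delta> \<Longrightarrow>
      \<bar>A z - A y - (z - y) * a y\<bar> \<le> \<epsilon>' * \<bar>z - y\<bar>"
    using uniformly_differentiable[OF deriv a \<open>\<epsilon>' > 0\<close>] by blast
  define d where "d = \<delta> / (1 + \<bar>R\<bar>)"
  have "d > 0" using \<open>\<delta> > 0\<close> by (simp add: d_def add_pos_nonneg)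
  define g where "g x = 1 / d * (x ^ j * A ((c + d) * x + b)) + - (1 / d) * (x ^ j * A (c * x + b))" for x
  have "approximable \<theta> {-R..R} g"
    unfolding g_def by (intro approximable_add approximable_cmult A)
  moreover have "\<bar>x ^ Suc j * a (c * x + b) - g x\<bar> \<le> \<epsilon>" if x: "x \<in> {-R..R}" for x
  proof -
    have xR: "\<bar>x\<bar> \<le> \<bar>R\<bar>" using x by auto
    define y z where "y = c * x + b" and "z = (c + d) * x + b"
    have zy: "z - y = d * x" by (simp add: y_def z_def algebra_simps)
    have "\<bar>c * x\<bar> \<le> \<bar>c\<bar> * \<bar>R\<bar>" using xR by (simp add: abs_mult mult_left_mono)
    then have "\<bar>y\<bar> \<le> \<bar>c\<bar> * \<bar>R\<bar> + \<bar>b\<bar>" unfolding y_def by linarith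
    moreover have "\<bar>z - y\<bar> \<le> \<delta>"
    proof -
      have "\<bar>z - y\<bar> \<le> d * (1 + \<bar>R\<bar>)"
        using xR \<open>d > 0\<close> by (simp add: zy abs_mult)
      also have "\<dots> = \<delta>" by (simp add: d_def add_eq_0_iff)
      finally show ?thesis .
    qed
    ultimately have *: "\<bar>A z - A y - d * x * a y\<bar> \<le> \<epsilon>' * \<bar>d * x\<bar>"
      using \<delta>[of y z] by (simp add: zy)
    have "x ^ Suc j * a y - g x = - (x ^ j * (A z - A y - d * x * a y) / d)"
      using \<open>d > 0\<close> by (simp add: g_def y_def z_def field_simps)
    then have "\<bar>x ^ Suc j * a y - g x\<bar> = \<bar>x\<bar> ^ j * \<bar>A z - A y - d * x * a y\<bar> / d"
      using \<open>d > 0\<close> by (simp add: abs_mult power_abs)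
    also have "\<dots> \<le> \<bar>x\<bar> ^ j * (\<epsilon>' * \<bar>d * x\<bar>) / d"
      using * \<open>d > 0\<close> by (intro divide_right_mono mult_left_mono) auto
    also have "\<dots> = \<bar>x\<bar> ^ Suc j * \<epsilon>'"
      using \<open>d > 0\<close> by (simp add: abs_mult)
    also have "\<dots> \<le> (1 + \<bar>R\<bar> ^ Suc j) * \<epsilon>'"
      using power_mono[OF xR, of "Suc j"] \<open>\<epsilon>' > 0\<close> by (intro mult_right_mono) auto
    also have "\<dots> = \<epsilon>" using pos by (simp add: \<epsilon>'_def)
    finally show ?thesis by (simp add: y_def)
  qed
  ultimately show "\<exists>g. approximable \<theta> {-R..R} g \<and>
      (\<forall>x\<in>{-R..R}. \<bar>x ^ Suc j * a (c * x + b) - g x\<bar> \<le> \<epsilon>)" by blast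
qed

text \<open>Smoothing \<open>f\<close> by a moving average gains one derivative, and the derivative of the moving average is
  a forward difference of \<open>f\<close>. Hence one power of \<open>x\<close> is gained without assuming that \<open>f\<close> is
  differentiable.\<close>

lemma approximable_dilations_forward_diff:
  assumes f: "approximable_dilations \<theta> j f" and "h > 0"
  shows "approximable_dilations \<theta> (Suc j) (forward_diff h f)"
proof -
  have cont: "continuous_on UNIV f" using f by (simp add: approximable_dilations_def)
  obtain F where F: "\<And>x. (F has_real_derivative f x) (at x)"
    using continuous_has_antiderivative[OF cont] by blast
  have deriv: "(forward_diff h F has_real_derivative forward_diff h f x) (at x)" for x
    unfolding forward_diff_def
    by (auto intro!: derivative_eq_intros DERIV_chain'[OF _ F, THEN DERIV_cong] F)
  have cont': "continuous_on UNIV (forward_diff h f)"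
    unfolding forward_diff_def by (intro continuous_intros continuous_on_compose2[OF cont]) auto
  then show ?thesis
    unfolding approximable_dilations_def[of _ "Suc j"]
    using approximable_dilations_deriv[OF approximable_dilations_increment[OF f \<open>h > 0\<close> F] deriv cont']
    by blast
qed

text \<open>After \<open>k\<close> smoothing steps, the dilation parameter \<open>c = 0\<close> leaves \<open>x ^ k\<close> times the number
  \<open>(forward_diff h ^^ k) \<theta> b\<close>. Some choice of \<open>h\<close> and \<open>b\<close> makes this number nonzero, since otherwise
  \<open>\<theta>\<close> would be a polynomial.\<close>

lemma approximable_monomial:
  assumes cont: "continuous_on UNIV \<theta>" and "\<nexists>p. \<forall>x. \<theta> x = poly p x"
  shows "approximable \<theta> {-R..R} (\<lambda>x. x ^ k)"
proof -
  obtain h b where "h > 0" and nz: "(forward_diff h ^^ k) \<theta> b \<noteq> 0"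
    using polynomial_if_differences_vanish[OF cont, of k] assms(2) by blast
  have "approximable_dilations \<theta> 0 \<theta>"
    unfolding approximable_dilations_def
  proof (intro conjI allI cont)
    fix c b R
    show "approximable \<theta> {-R..R} (\<lambda>x. x ^ 0 * \<theta> (c * x + b))"
      by (rule approximable_cong[OF approximable_ridge_sum[of _ _ "[(1, c, b)]"]]) simp
  qed
  then have "approximable_dilations \<theta> k ((forward_diff h ^^ k) \<theta>)"
    using \<open>h > 0\<close> by (induction k) (auto intro: approximable_dilations_forward_diff)
  then have "approximable \<theta> {-R..R} (\<lambda>x. x ^ k * (forward_diff h ^^ k) \<theta> (0 * x + b))"
    unfolding approximable_dilations_def by blast
  then have "approximable \<theta> {-R..R} (\<lambda>x. 1 / (forward_diff h ^^ k) \<theta> b *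
      (x ^ k * (forward_diff h ^^ k) \<theta> (0 * x + b)))"
    by (rule approximable_cmult)
  then show ?thesis by (rule approximable_cong) (use nz in simp)
qed

lemma approximable_continuous_real:
  fixes g :: "real \<Rightarrow> real"
  assumes "continuous_on UNIV \<theta>" "\<nexists>p. \<forall>x. \<theta> x = poly p x" and g: "continuous_on {-R..R} g"
  shows "approximable \<theta> {-R..R} g"
proof (rule approximable_limit)
  fix \<epsilon> :: real assume "\<epsilon> > 0"
  then obtain q where q: "polynomial_function q" "\<forall>x\<in>{-R..R}. norm (g x - q x) < \<epsilon>"
    using Stone_Weierstrass_polynomial_function[OF compact_Icc g] by blast
  then obtain a n where "q = (\<lambda>x. \<Sum>i\<le>n. a i * x ^ i)"
    using real_polynomial_function_eq real_polynomial_function_iff_sum by metis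
  then have "approximable \<theta> {-R..R} q"
    by (auto intro!: approximable_sum approximable_cmult approximable_monomial assms)
  then show "\<exists>q. approximable \<theta> {-R..R} q \<and> (\<forall>x\<in>{-R..R}. \<bar>g x - q x\<bar> \<le> \<epsilon>)"
    using q(2) by (intro exI[of _ q]) (auto intro: less_imp_le)
qed

section \<open>Universal approximation in inner product spaces\<close>

lemma ridge_sum_exp_mult:
  "\<exists>L''. \<forall>x. ridge_sum exp L x * ridge_sum exp L' x = ridge_sum exp L'' x"
proof (induction L)
  case Nil
  show ?case by (intro exI[of _ "[]"]) simp
next
  case (Cons p L)
  obtain c w b where p: "p = (c, w, b)" by (cases p)
  have *: "c * exp (inner w x + b) * ridge_sum exp L' x =
      ridge_sum exp (map (\<lambda>(d, v, a). (c * d, w + v, b + a)) L') x" for x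
    by (induction L') (auto simp: algebra_simps exp_add inner_add_left)
  obtain L1 where "\<forall>x. ridge_sum exp L x * ridge_sum exp L' x = ridge_sum exp L1 x"
    using Cons.IH by blast
  then show ?case
    by (intro exI[of _ "map (\<lambda>(d, v, a). (c * d, w + v, b + a)) L' @ L1"])
      (simp add: p distrib_right *)
qed

text \<open>Exponential networks form an algebra, because products of exponentials are exponentials of sums, so
  the Stone-Weierstrass theorem applies to them directly. This avoids expressing multivariate monomials
  through powers of linear forms.\<close>

lemma approximable_exp:
  fixes K :: "'a::real_inner set"
  assumes "compact K" and g: "continuous_on K g"
  shows "approximable exp K g"
proof -
  interpret function_ring_on "range (ridge_sum exp)" K
  proof
    show "compact K" by fact
    show "continuous_on K f" if "f \<in> range (ridge_sum exp)" for f :: "'a \<Rightarrow> real"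
    proof -
      have "continuous_on K (ridge_sum exp L)" for L :: "(real \<times> 'a \<times> real) list"
        by (induction L) (auto intro!: continuous_intros)
      with that show ?thesis by auto
    qed
    show "(\<lambda>x. f x + g x) \<in> range (ridge_sum exp)"
      if fg: "f \<in> range (ridge_sum exp)" "g \<in> range (ridge_sum exp)" for f g :: "'a \<Rightarrow> real"
    proof -
      obtain L L' where "f = ridge_sum exp L" "g = ridge_sum exp L'" using fg by blast
      then show ?thesis by (intro range_eqI[of _ _ "L @ L'"]) (simp add: fun_eq_iff)
    qed
    show "(\<lambda>x. f x * g x) \<in> range (ridge_sum exp)"
      if fg: "f \<in> range (ridge_sum exp)" "g \<in> range (ridge_sum exp)" for f g :: "'a \<Rightarrow> real"
    proof -
      obtain L L' where L: "f = ridge_sum exp L" "g = ridge_sum exp L'" using fg by blast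
      obtain L'' where "\<forall>x. ridge_sum exp L x * ridge_sum exp L' x = ridge_sum exp L'' x"
        using ridge_sum_exp_mult by blast
      then show ?thesis by (intro range_eqI[of _ _ L'']) (simp add: L fun_eq_iff)
    qed
    show "(\<lambda>_. c) \<in> range (ridge_sum exp)" for c
      by (rule range_eqI[of _ _ "[(c, 0, 0)]"]) (simp add: fun_eq_iff)
    show "\<exists>f\<in>range (ridge_sum exp). f x \<noteq> f y" if "x \<noteq> y" for x y :: 'a
    proof -
      have "inner (x - y) x - inner (x - y) y \<noteq> 0"
        using that unfolding inner_diff_right[symmetric] by simp
      then have "ridge_sum exp [(1, x - y, 0)] x \<noteq> ridge_sum exp [(1, x - y, 0)] y" by simp
      then show ?thesis by blast
    qed
  qed
  show ?thesis
    unfolding approximable_def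
    using Stone_Weierstrass_basic[OF g] by (force intro: less_imp_le)
qed

text \<open>The universal approximation theorem for continuous activations that are not polynomials, on
  compact subsets of an arbitrary real inner product space.\<close>

theorem universal_approximation:
  fixes K :: "'a::real_inner set"
  assumes "continuous_on UNIV \<theta>" "\<nexists>p. \<forall>x. \<theta> x = poly p x"
    and "compact K" "continuous_on K g"
  shows "approximable \<theta> K g"
proof (rule approximable_trans)
  show "approximable exp K g" using assms(3,4) by (rule approximable_exp)
  show "bounded K" using assms(3) by (rule compact_imp_bounded)
  show "approximable \<theta> {-R..R} exp" for R
    using assms(1,2) by (intro approximable_continuous_real) (auto intro: continuous_intros)
qed

section \<open>The cosine basis and the projections\<close>

lemma integrable_Lam_continuous:
  fixes f :: "real \<Rightarrow> real"
  assumes f: "continuous_on UNIV f"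
  shows "integrable Lam f" and "integral\<^sup>L Lam f = integral {0..1} f"
proof -
  have "set_integrable lebesgue {0..1} f"
    using f by (intro absolutely_integrable_continuous_real) (auto intro: continuous_on_subset)
  then have "set_integrable lebesgue {0<..<1} f"
    by (rule set_integrable_subset) auto
  then show *: "integrable Lam f"
    by (simp add: integrable_restrict_space set_integrable_def)
  show "integral\<^sup>L Lam f = integral {0..1} f"
    using lebesgue_integral_eq_integral[OF *] by (simp add: integral_open_interval_real)
qed

lemma square_integrable_continuous:
  assumes f: "continuous_on UNIV f"
  shows "square_integrable f"
  unfolding square_integrable_def
proof
  show "f \<in> borel_measurable Lam"
    using integrable_Lam_continuous(1)[OF f] by (rule borel_measurable_integrable)
  show "integrable Lam (\<lambda>x. (f x)\<^sup>2)"
    by (intro integrable_Lam_continuous continuous_intros f)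
qed

lemma inner_abs_L2:
  assumes "continuous_on UNIV f" "continuous_on UNIV g"
  shows "inner (abs_L2 f) (abs_L2 g) = integral {0..1} (\<lambda>x. f x * g x)"
proof -
  have "inner (abs_L2 f) (abs_L2 g) = integral\<^sup>L Lam (\<lambda>x. f x * g x)"
    using assms by (intro inner_L2.abs_eq) (auto simp: L2_rel_def square_integrable_continuous)
  also have "\<dots> = integral {0..1} (\<lambda>x. f x * g x)"
    by (intro integrable_Lam_continuous continuous_intros assms)
  finally show ?thesis .
qed

text \<open>The frequency is an integer so that differences of frequencies of basis functions are covered.\<close>

lemma has_integral_cos_int_pi:
  "((\<lambda>x. cos (of_int k * pi * x)) has_integral (if k = 0 then 1 else 0)) {0..1}"
proof (cases "k = 0")
  case True
  then show ?thesis using has_integral_const_real[of "1::real" 0 1] by simp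
next
  case False
  define c where "c = of_int k * pi"
  have "c \<noteq> 0" using False by (simp add: c_def)
  have "((\<lambda>x. cos (c * x)) has_integral sin (c * 1) / c - sin (c * 0) / c) {0..1}"
  proof (rule fundamental_theorem_of_calculus)
    fix x :: real
    show "((\<lambda>x. sin (c * x) / c) has_vector_derivative cos (c * x)) (at x within {0..1})"
      unfolding has_real_derivative_iff_has_vector_derivative[symmetric]
      by (auto intro!: derivative_eq_intros simp: \<open>c \<noteq> 0\<close>)
  qed simp
  moreover have "sin c = 0"
    unfolding c_def by (simp add: sin_times_pi_eq_0)
  ultimately show ?thesis using False by (simp add: c_def)
qed

lemma e_basis_orthonormal: "inner (e_basis i) (e_basis j) = (if i = j then 1 else 0)"
proof -
  define a :: "nat \<Rightarrow> real" where "a k = (if k = 0 then 1 else sqrt 2)" for k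
  have e: "e_basis k = abs_L2 (\<lambda>x. a k * cos (real k * pi * x))" for k
    by (auto simp: e_basis_def a_def)
  have prod: "a i * cos (real i * pi * x) * (a j * cos (real j * pi * x)) =
      a i * a j / 2 * (cos (of_int (int i - int j) * pi * x) + cos (of_int (int i + int j) * pi * x))"
    for x
  proof -
    have "cos (real i * pi * x) * cos (real j * pi * x) =
        (cos (real i * pi * x - real j * pi * x) + cos (real i * pi * x + real j * pi * x)) / 2"
      by (rule cos_times_cos)
    moreover have "a i * cos (real i * pi * x) * (a j * cos (real j * pi * x)) =
        a i * a j * (cos (real i * pi * x) * cos (real j * pi * x))" by (simp only: ac_simps)
    ultimately show ?thesis by (simp add: left_diff_distrib distrib_right)
  qed
  have "inner (e_basis i) (e_basis j) = integral {0..1}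
      (\<lambda>x. a i * cos (real i * pi * x) * (a j * cos (real j * pi * x)))"
    unfolding e by (intro inner_abs_L2 continuous_intros)
  also have "\<dots> = a i * a j / 2 *
      ((if int i - int j = 0 then 1 else 0) + (if int i + int j = 0 then 1 else 0))"
    unfolding prod
    by (intro integral_unique has_integral_mult_right has_integral_add has_integral_cos_int_pi)
  also have "\<dots> = (if i = j then 1 else 0)"
    by (auto simp: a_def)
  finally show ?thesis .
qed

lemma inner_sum_basis:
  "inner (\<Sum>i\<le>n. c i *\<^sub>R e_basis i) (e_basis j) = (if j \<le> n then c j else 0)"
  by (simp add: inner_sum_left e_basis_orthonormal if_distrib cong: if_cong)

lemma P_proj_eq: "P_proj n u = (\<Sum>i\<le>n. inner u (e_basis i) *\<^sub>R e_basis i)"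
  unfolding P_proj_def
proof (rule the_equality)
  let ?p = "\<Sum>i\<le>n. inner u (e_basis i) *\<^sub>R e_basis i"
  have p: "?p \<in> S_space n"
    unfolding S_space_def by (intro span_sum span_scale span_base) auto
  have orth: "inner (u - ?p) w = 0" if "w \<in> S_space n" for w
    using that unfolding S_space_def
    by (induction rule: span_induct_alt)
      (auto simp: inner_add_right inner_diff_left inner_sum_basis)
  show "?p \<in> S_space n \<and> (\<forall>w\<in>S_space n. inner (u - ?p) w = 0)"
    using p orth by blast
  fix q assume q: "q \<in> S_space n \<and> (\<forall>w\<in>S_space n. inner (u - q) w = 0)"
  have "q - ?p \<in> S_space n"
    using p q unfolding S_space_def by (auto intro: span_diff)
  then have "inner (u - ?p) (q - ?p) = 0" "inner (u - q) (q - ?p) = 0"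
    using orth q by auto
  then have "inner (q - ?p) (q - ?p) = 0"
    by (simp add: inner_diff_left)
  then show "q = ?p" by simp
qed

lemma inner_P_proj_basis: "i \<le> n \<Longrightarrow> inner (P_proj n u) (e_basis i) = inner u (e_basis i)"
  by (simp add: P_proj_eq inner_sum_basis)

lemma P_proj_sum_basis: "P_proj n (\<Sum>i\<le>n. c i *\<^sub>R e_basis i) = (\<Sum>i\<le>n. c i *\<^sub>R e_basis i)"
  by (simp add: P_proj_eq inner_sum_basis)

lemma P_proj_idem: "P_proj n (P_proj n u) = P_proj n u"
  unfolding P_proj_eq[of n u] by (rule P_proj_sum_basis)

lemma P_proj_diff: "P_proj n (u - v) = P_proj n u - P_proj n v"
  by (simp add: P_proj_eq inner_diff_left scaleR_left_diff_distrib sum_subtractf)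

lemma P_proj_scaleR: "P_proj n (c *\<^sub>R u) = c *\<^sub>R P_proj n u"
  by (simp add: P_proj_eq scaleR_sum_right)

lemma inner_P_proj: "inner w (P_proj n u) = (\<Sum>i\<le>n. inner w (e_basis i) * inner u (e_basis i))"
  by (simp add: P_proj_eq inner_sum_right mult.commute)

lemma norm_P_proj_le: "norm (P_proj n u) \<le> norm u"
proof -
  have "inner (P_proj n u) (P_proj n u) = inner u (P_proj n u)"
    by (simp add: inner_P_proj inner_P_proj_basis)
  then have "(norm (P_proj n u))\<^sup>2 \<le> norm u * norm (P_proj n u)"
    using norm_cauchy_schwarz[of u "P_proj n u"] by (simp add: power2_norm_eq_inner)
  then show ?thesis
    by (cases "P_proj n u = 0") (auto simp: power2_eq_square)
qed

lemma norm_e_basis: "norm (e_basis i) = 1"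
  by (simp add: norm_eq_sqrt_inner e_basis_orthonormal)

section \<open>The radial cutoff\<close>

definition radial_retraction :: "real \<Rightarrow> 'a::real_normed_vector \<Rightarrow> 'a" where
  "radial_retraction r u = (if norm u \<le> r then u else (r / norm u) *\<^sub>R u)"

lemma norm_radial_retraction_le:
  assumes "r \<ge> 0"
  shows "norm (radial_retraction r u) \<le> r" "norm (radial_retraction r u) \<le> norm u"
  using assms by (auto simp: radial_retraction_def)

text \<open>The constant \<open>2\<close> comes from the triangle inequality after writing the retraction as
  \<open>(r / m u) *\<^sub>R u\<close> with \<open>m u = max r (norm u)\<close>, a formula without case distinction.\<close>

lemma lipschitz_radial_retraction:
  assumes "r > 0"
  shows "2-lipschitz_on UNIV (radial_retraction r :: 'a::real_normed_vector \<Rightarrow> 'a)"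
proof (rule lipschitz_onI)
  fix u v :: 'a
  define m where "m w = max r (norm w)" for w :: 'a
  have m: "m w > 0" "r / m w \<le> 1" "norm w / m w \<le> 1" for w
    using assms by (auto simp: m_def field_simps)
  have rad: "radial_retraction r w = (r / m w) *\<^sub>R w" for w
    using assms by (auto simp: radial_retraction_def m_def max_def)
  have "radial_retraction r u - radial_retraction r v =
      (r / m u) *\<^sub>R (u - v) + ((r / m u) * ((m v - m u) / m v)) *\<^sub>R v"
  proof -
    have "(r / m u) * ((m v - m u) / m v) = r / m u - r / m v"
      using m(1)[of u] m(1)[of v] by (simp add: field_simps)
    then show ?thesis by (simp add: rad scaleR_diff_right scaleR_left_diff_distrib)
  qed
  also have "norm \<dots> \<le> (r / m u) * norm (u - v) + (r / m u) * \<bar>m v - m u\<bar> * (norm v / m v)"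
    using m(1)[of u] m(1)[of v] assms
    by (intro norm_triangle_le add_mono) (simp_all add: abs_mult)
  also have "\<dots> \<le> 1 * norm (u - v) + (1 * norm (u - v)) * 1"
  proof (intro add_mono mult_mono m)
    show "\<bar>m v - m u\<bar> \<le> norm (u - v)"
      using norm_triangle_ineq3[of u v] unfolding m_def by linarith
  qed (use m(1)[of u] m(1)[of v] assms in \<open>auto intro!: mult_nonneg_nonneg\<close>)
  finally show "dist (radial_retraction r u) (radial_retraction r v) \<le> 2 * dist u v"
    by (simp add: dist_norm)
qed simp

lemma P_proj_radial_retraction:
  "P_proj n (radial_retraction r (P_proj n u)) = radial_retraction r (P_proj n u)"
  by (simp add: radial_retraction_def P_proj_scaleR P_proj_idem)

lemma dim_coordinates [simp]: "dim_vec (coordinates n u) = n + 1"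
  by (simp add: coordinates_def)

lemma index_coordinates [simp]:
  "i \<le> n \<Longrightarrow> vec_index (coordinates n u) i = inner u (e_basis i)"
  by (simp add: coordinates_def)

lemma euclidean_norm_coordinates: "euclidean_norm (coordinates n u) = norm (P_proj n u)"
proof -
  have "(\<Sum>i<n + 1. (vec_index (coordinates n u) i)\<^sup>2) = (\<Sum>i\<le>n. (inner u (e_basis i))\<^sup>2)"
    by (intro sum.cong) auto
  also have "\<dots> = inner (P_proj n u) (P_proj n u)"
    by (simp add: inner_P_proj inner_P_proj_basis power2_eq_square)
  finally show ?thesis
    by (simp add: euclidean_norm_def norm_eq_sqrt_inner)
qed

text \<open>By orthonormality the coordinates carry the norm of the projection, so the cutoff in
  coordinate space is a radial retraction in \<^typ>\<open>L2\<close>. From here on, matrices and coordinate vectors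
  only enter through the translation between networks and ridge sums.\<close>

lemma cutoff_coordinates:
  "cutoff l (coordinates n u) = coordinates n (radial_retraction (real l) (P_proj n u))"
  by (rule eq_vecI)
    (auto simp: cutoff_def radial_retraction_def euclidean_norm_coordinates inner_P_proj_basis)

section \<open>Networks as ridge sums\<close>

lemma index_network:
  assumes "A \<in> carrier_mat k (n + 2)" "a \<in> carrier_vec k" "B \<in> carrier_mat (n + 1) k" "i \<le> n"
  shows "vec_index (B *\<^sub>v map_vec \<theta> (A *\<^sub>v vCons t (coordinates n v) + a)) i =
    (\<Sum>j<k. B $$ (i, j) *
      \<theta> (A $$ (j, 0) * t + (\<Sum>p\<le>n. A $$ (j, Suc p) * inner v (e_basis p)) + vec_index a j))"
proof -
  have "vec_index (A *\<^sub>v vCons t (coordinates n v) + a) j =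
      A $$ (j, 0) * t + (\<Sum>p\<le>n. A $$ (j, Suc p) * inner v (e_basis p)) + vec_index a j"
    if "j < k" for j
  proof -
    have "vec_index (A *\<^sub>v vCons t (coordinates n v) + a) j =
        (\<Sum>p<Suc (Suc n). A $$ (j, p) * vec_index (vCons t (coordinates n v)) p) + vec_index a j"
      using assms that by (simp add: scalar_prod_def lessThan_atLeast0)
    also have "(\<Sum>p<Suc (Suc n). A $$ (j, p) * vec_index (vCons t (coordinates n v)) p) =
        A $$ (j, 0) * vec_index (vCons t (coordinates n v)) 0 +
        (\<Sum>p<Suc n. A $$ (j, Suc p) * vec_index (vCons t (coordinates n v)) (Suc p))"
      by (rule sum.lessThan_Suc_shift)
    also have "\<dots> = A $$ (j, 0) * t + (\<Sum>p\<le>n. A $$ (j, Suc p) * inner v (e_basis p))"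
      unfolding lessThan_Suc_atMost by (auto simp: vec_index_vCons intro!: sum.cong)
    finally show ?thesis .
  qed
  then show ?thesis
    using assms by (simp add: scalar_prod_def lessThan_atLeast0)
qed

lemma ridge_sum_map_upt:
  "ridge_sum \<theta> (map (\<lambda>j. (c j, w j, b j)) [0..<k]) x = (\<Sum>j<k. c j * \<theta> (inner (w j) x + b j))"
  by (simp add: ridge_sum_def o_def interv_sum_list_conv_sum_set_nat lessThan_atLeast0)

text \<open>The row of inner weights of a hidden unit becomes the pair of its time weight and the element
  of \<^typ>\<open>L2\<close> with the remaining weights as coefficients.\<close>

lemma network_eq_ridge_sums:
  assumes "\<psi> \<in> all_networks \<theta> n"
  shows "\<exists>L. \<forall>i\<le>n. \<forall>t v. vec_index (\<psi> t (coordinates n v)) i = ridge_sum \<theta> (L i) (t, v)"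
proof -
  obtain k A a B where AaB: "A \<in> carrier_mat k (n + 2)" "a \<in> carrier_vec k" "B \<in> carrier_mat (n + 1) k"
    and \<psi>: "\<psi> = (\<lambda>t x. B *\<^sub>v map_vec \<theta> (A *\<^sub>v vCons t x + a))"
    using assms by (auto simp: all_networks_def networks_def)
  define L where "L i = map (\<lambda>j. (B $$ (i, j),
      (A $$ (j, 0), \<Sum>p\<le>n. A $$ (j, Suc p) *\<^sub>R e_basis p), vec_index a j)) [0..<k]" for i
  have "vec_index (\<psi> t (coordinates n v)) i = ridge_sum \<theta> (L i) (t, v)" if "i \<le> n" for i t v
    unfolding \<psi> L_def ridge_sum_map_upt index_network[OF AaB that]
    by (simp add: inner_sum_left inner_commute[of v])
  then show ?thesis by blast
qed

text \<open>A vector-valued network has one hidden layer for all outputs. The scalar networks are put side by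
  side, and the outer weight of each unit becomes a function of the output index that vanishes
  except at the output to which the unit belongs.\<close>

lemma merge_ridge_sums:
  fixes m :: nat
  shows "\<exists>D \<noteq> []. \<forall>i<m. \<forall>x. ridge_sum \<theta> (L i) x = (\<Sum>(c, w, b)\<leftarrow>D. c i * \<theta> (inner w x + b))"
proof (induction m)
  case 0
  \<comment> \<open>A dummy entry keeps the list nonempty: a network has at least one hidden unit.\<close>
  show ?case by (intro exI[of _ "[undefined]"]) simp
next
  case (Suc m)
  then obtain D where "D \<noteq> []"
    and D: "\<And>i x. i < m \<Longrightarrow> ridge_sum \<theta> (L i) x = (\<Sum>(c, w, b)\<leftarrow>D. c i * \<theta> (inner w x + b))"
    by blast
  define D1 where "D1 = map (\<lambda>(c, w, b). (c(m := 0), w, b)) D"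
  define D2 where "D2 = map (\<lambda>(c, w, b). ((\<lambda>i. if i = m then c else 0), w, b)) (L m)"
  have D1: "(\<Sum>(c, w, b)\<leftarrow>D1. c i * \<theta> (inner w x + b)) =
      (if i = m then 0 else \<Sum>(c, w, b)\<leftarrow>D. c i * \<theta> (inner w x + b))" for i x
    unfolding D1_def by (induction D) auto
  have "(\<Sum>(c, w, b)\<leftarrow>map (\<lambda>(c, w, b). ((\<lambda>i. if i = m then c else 0), w, b)) L'.
      c i * \<theta> (inner w x + b)) = (if i = m then ridge_sum \<theta> L' x else 0)" for L' i x
    by (induction L') (auto simp: ridge_sum_def)
  then have D2: "(\<Sum>(c, w, b)\<leftarrow>D2. c i * \<theta> (inner w x + b)) =
      (if i = m then ridge_sum \<theta> (L m) x else 0)" for i x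
    unfolding D2_def by blast
  have "D1 @ D2 \<noteq> []" using \<open>D \<noteq> []\<close> by (simp add: D1_def)
  moreover have "\<forall>i<Suc m. \<forall>x. ridge_sum \<theta> (L i) x =
      (\<Sum>(c, w, b)\<leftarrow>D1 @ D2. c i * \<theta> (inner w x + b))"
    by (auto simp: D1 D2 D less_Suc_eq)
  ultimately show ?case by blast
qed

text \<open>The inner weights in \<^typ>\<open>L2\<close> need not lie in the span of the first basis elements. The matrix only
  sees their projections, which is enough because \<open>v\<close> lies in that span.\<close>

lemma ridge_sums_eq_network:
  "\<exists>\<psi>\<in>all_networks \<theta> n. \<forall>i\<le>n. \<forall>t v. P_proj n v = v \<longrightarrow>
     vec_index (\<psi> t (coordinates n v)) i = ridge_sum \<theta> (L i) (t, v)"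
proof -
  obtain D where "D \<noteq> []" and
    "\<forall>i<Suc n. \<forall>x. ridge_sum \<theta> (L i) x = (\<Sum>(c, w, b)\<leftarrow>D. c i * \<theta> (inner w x + b))"
    using merge_ridge_sums[of "Suc n" \<theta> L] by blast
  then have D: "ridge_sum \<theta> (L i) x =
      (\<Sum>j<length D. fst (D ! j) i * \<theta> (inner (fst (snd (D ! j))) x + snd (snd (D ! j))))"
    if "i \<le> n" for i x
    using that
    by (simp add: sum_list_sum_nth case_prod_unfold lessThan_atLeast0 del: split_paired_All)
  define k where "k = length D"
  define A where "A = mat k (n + 2) (\<lambda>(j, p). case p of 0 \<Rightarrow> fst (fst (snd (D ! j)))
      | Suc p \<Rightarrow> inner (snd (fst (snd (D ! j)))) (e_basis p))"
  define a where "a = vec k (\<lambda>j. snd (snd (D ! j)))"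
  define B where "B = mat (n + 1) k (\<lambda>(i, j). fst (D ! j) i)"
  have AaB: "A \<in> carrier_mat k (n + 2)" "a \<in> carrier_vec k" "B \<in> carrier_mat (n + 1) k"
    by (simp_all add: A_def a_def B_def)
  define \<psi> where "\<psi> t x = B *\<^sub>v map_vec \<theta> (A *\<^sub>v vCons t x + a)" for t x
  have "vec_index (\<psi> t (coordinates n v)) i = ridge_sum \<theta> (L i) (t, v)"
    if "i \<le> n" and v: "P_proj n v = v" for i t v
  proof -
    have w: "inner w v = (\<Sum>p\<le>n. inner w (e_basis p) * inner v (e_basis p))" for w
      using inner_P_proj[of w n v] v by simp
    show ?thesis
      unfolding \<psi>_def index_network[OF AaB that(1)] D[OF that(1)] k_def[symmetric]
      using that(1) by (intro sum.cong) (auto simp: A_def a_def B_def inner_prod_def w)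
  qed
  moreover have "\<psi> \<in> networks \<theta> n k"
    unfolding networks_def mem_Collect_eq
    by (intro exI[of _ A] exI[of _ a] exI[of _ B] conjI AaB) (simp add: \<psi>_def[abs_def])
  then have "\<psi> \<in> all_networks \<theta> n"
    using \<open>D \<noteq> []\<close> unfolding all_networks_def k_def by (cases D) auto
  ultimately show ?thesis by blast
qed

text \<open>The coordinate-free form of the feedbacks in \<^const>\<open>network_feedbacks\<close>, with the cutoff radius
  \<open>r\<close>.\<close>

definition ridge_feedback ::
  "(real \<Rightarrow> real) \<Rightarrow> nat \<Rightarrow> real \<Rightarrow> (nat \<Rightarrow> (real \<times> (real \<times> L2) \<times> real) list) \<Rightarrow> real \<Rightarrow> L2 \<Rightarrow> L2" where
  "ridge_feedback \<theta> n r L t u =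
     (\<Sum>i\<le>n. ridge_sum \<theta> (L i) (t, radial_retraction r (P_proj n u)) *\<^sub>R e_basis i)"

lemma network_feedbacks_subset:
  assumes "G \<in> network_feedbacks T \<theta>"
  shows "\<exists>n r L. r > 0 \<and> (\<forall>t\<in>{0..T}. \<forall>u. G t u = ridge_feedback \<theta> n r L t u)"
proof -
  obtain n l \<psi> where \<psi>: "\<psi> \<in> all_networks \<theta> n" "1 \<le> l" and
    G: "\<And>t u. t \<in> {0..T} \<Longrightarrow>
      G t u = (\<Sum>i\<le>n. vec_index (\<psi> t (cutoff l (coordinates n u))) i *\<^sub>R e_basis i)"
    using assms unfolding network_feedbacks_def by blast
  obtain L where
    L: "\<And>i t v. i \<le> n \<Longrightarrow> vec_index (\<psi> t (coordinates n v)) i = ridge_sum \<theta> (L i) (t, v)"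
    using network_eq_ridge_sums[OF \<psi>(1)] by blast
  have "G t u = ridge_feedback \<theta> n (real l) L t u" if "t \<in> {0..T}" for t u
    unfolding G[OF that] ridge_feedback_def cutoff_coordinates
    by (intro sum.cong refl) (simp add: L)
  with \<psi>(2) show ?thesis by (intro exI[of _ n] exI[of _ "real l"] exI[of _ L]) simp
qed

lemma ridge_feedback_in_network_feedbacks:
  assumes "1 \<le> l"
  shows "ridge_feedback \<theta> n (real l) L \<in> network_feedbacks T \<theta>"
proof -
  obtain \<psi> where "\<psi> \<in> all_networks \<theta> n" and
    \<psi>: "\<And>i t v. i \<le> n \<Longrightarrow> P_proj n v = v \<Longrightarrow>
      vec_index (\<psi> t (coordinates n v)) i = ridge_sum \<theta> (L i) (t, v)"
    using ridge_sums_eq_network[of \<theta> n L] by blast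
  moreover have "ridge_feedback \<theta> n (real l) L t u =
      (\<Sum>i\<le>n. vec_index (\<psi> t (cutoff l (coordinates n u))) i *\<^sub>R e_basis i)" for t u
    unfolding ridge_feedback_def cutoff_coordinates
    by (intro sum.cong refl) (simp add: \<psi> P_proj_radial_retraction)
  ultimately show ?thesis
    using assms unfolding network_feedbacks_def mem_Collect_eq
    by (intro exI[of _ n] exI[of _ l] bexI[of _ \<psi>]) auto
qed

section \<open>Admissibility of network feedbacks\<close>

lemma lipschitz_ridge_sum:
  assumes \<theta>: "K-lipschitz_on UNIV \<theta>"
  shows "\<exists>C. C-lipschitz_on UNIV (ridge_sum \<theta> L)"
proof (induction L)
  case Nil
  show ?case by (intro exI[of _ 0]) (simp add: lipschitz_on_def)
next
  case (Cons p L)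
  obtain c w b where p: "p = (c, w, b)" by (cases p)
  obtain C where C: "C-lipschitz_on UNIV (ridge_sum \<theta> L)" using Cons.IH by blast
  have "(norm w)-lipschitz_on UNIV (\<lambda>x. inner w x + b)"
  proof (rule lipschitz_onI)
    fix x y
    have "\<bar>inner w (x - y)\<bar> \<le> norm w * norm (x - y)" by (rule Cauchy_Schwarz_ineq2)
    then show "dist (inner w x + b) (inner w y + b) \<le> norm w * dist x y"
      by (simp add: dist_norm inner_diff_right)
  qed simp
  then have "(K * norm w)-lipschitz_on UNIV (\<lambda>x. \<theta> (inner w x + b))"
    by (rule lipschitz_on_compose2) (rule lipschitz_on_subset[OF \<theta>], simp)
  then have "(\<bar>c\<bar> * (K * norm w) + C)-lipschitz_on UNIV
      (\<lambda>x. c * \<theta> (inner w x + b) + ridge_sum \<theta> L x)"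
    by (intro lipschitz_on_add lipschitz_on_cmult_real C)
  then show ?case
    unfolding p ridge_sum_Cons[abs_def, symmetric] by (intro exI) simp
qed

lemma lipschitz_sum:
  fixes f :: "'i \<Rightarrow> 'a::metric_space \<Rightarrow> 'b::real_normed_vector"
  assumes "\<And>i. i \<in> I \<Longrightarrow> \<exists>C. C-lipschitz_on S (f i)"
  shows "\<exists>C. C-lipschitz_on S (\<lambda>x. \<Sum>i\<in>I. f i x)"
  using assms
proof (induction I rule: infinite_finite_induct)
  case (insert i I)
  then obtain C D where "C-lipschitz_on S (f i)" "D-lipschitz_on S (\<lambda>x. \<Sum>i\<in>I. f i x)"
    by blast
  then have "(C + D)-lipschitz_on S (\<lambda>x. f i x + (\<Sum>i\<in>I. f i x))"
    by (rule lipschitz_on_add)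
  then show ?case
    unfolding sum.insert[OF insert.hyps] by (rule exI)
qed (auto intro: lipschitz_on_constant)

lemma lipschitz_P_proj: "1-lipschitz_on UNIV (P_proj n)"
  by (rule lipschitz_onI) (simp_all add: dist_norm norm_P_proj_le flip: P_proj_diff)

text \<open>Joint Lipschitz continuity in time and state yields at once the continuity, the Lipschitz bound
  uniform in time and the growth bound that the state equation requires.\<close>

lemma lipschitz_ridge_feedback:
  assumes \<theta>: "K-lipschitz_on UNIV \<theta>" and "r > 0"
  shows "\<exists>C. C-lipschitz_on UNIV (\<lambda>(t, u). ridge_feedback \<theta> n r L t u)"
proof -
  have fst: "1-lipschitz_on UNIV (fst :: real \<times> L2 \<Rightarrow> real)"
    and snd: "1-lipschitz_on UNIV (snd :: real \<times> L2 \<Rightarrow> L2)"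
    by (rule lipschitz_onI; simp add: dist_fst_le dist_snd_le)+
  have "1-lipschitz_on UNIV (\<lambda>x :: real \<times> L2. P_proj n (snd x))"
    using lipschitz_on_compose2[OF snd lipschitz_on_subset[OF lipschitz_P_proj subset_UNIV]]
    by simp
  then have "(2 * 1)-lipschitz_on UNIV
      (\<lambda>x :: real \<times> L2. radial_retraction r (P_proj n (snd x)))"
    by (rule lipschitz_on_compose2)
      (rule lipschitz_on_subset[OF lipschitz_radial_retraction[OF \<open>r > 0\<close>] subset_UNIV])
  from lipschitz_on_Pair[OF fst this]
  obtain D where D: "D-lipschitz_on UNIV
      (\<lambda>x :: real \<times> L2. (fst x, radial_retraction r (P_proj n (snd x))))"
    by blast
  have "\<exists>C. C-lipschitz_on UNIV (\<lambda>x. ridge_sum \<theta> (L i)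
      (fst x, radial_retraction r (P_proj n (snd x))) *\<^sub>R e_basis i)" for i
  proof -
    obtain C where C: "C-lipschitz_on UNIV (ridge_sum \<theta> (L i))"
      using lipschitz_ridge_sum[OF \<theta>] by blast
    have "(C * D)-lipschitz_on UNIV
        (\<lambda>x. ridge_sum \<theta> (L i) (fst x, radial_retraction r (P_proj n (snd x))))"
      by (rule lipschitz_on_compose2[OF D lipschitz_on_subset[OF C subset_UNIV]])
    then have "(C * D)-lipschitz_on UNIV (\<lambda>x. ridge_sum \<theta> (L i)
        (fst x, radial_retraction r (P_proj n (snd x))) *\<^sub>R e_basis i)"
      by (simp add: lipschitz_on_def dist_norm norm_e_basis flip: scaleR_left_diff_distrib)
    then show ?thesis by blast
  qed
  then have "\<exists>C. C-lipschitz_on UNIV (\<lambda>x. \<Sum>i\<le>n. ridge_sum \<theta> (L i)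
      (fst x, radial_retraction r (P_proj n (snd x))) *\<^sub>R e_basis i)"
    by (intro lipschitz_sum)
  then show ?thesis by (simp add: ridge_feedback_def case_prod_unfold)
qed

text \<open>The space \<open>'b\<close> need not be second countable, so sums of measurable functions into it are not
  automatically measurable. Here the sum factors through the sequence space \<open>nat \<Rightarrow> real\<close>, which is
  second countable, followed by a continuous map.\<close>

lemma borel_measurable_coefficients:
  fixes c :: "nat \<Rightarrow> 'x \<Rightarrow> real" and e :: "nat \<Rightarrow> 'b::real_normed_vector"
  assumes c: "\<And>i. c i \<in> borel_measurable N"
  shows "(\<lambda>x. \<Sum>i\<le>n. c i x *\<^sub>R e i) \<in> borel_measurable N"
proof -
  have "(\<lambda>x i. c i x) \<in> borel_measurable N"
    using c by (intro measurable_coordinatewise_then_product)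
  moreover have "(\<lambda>a :: nat \<Rightarrow> real. \<Sum>i\<le>n. a i *\<^sub>R e i) \<in> borel_measurable borel"
    by (intro borel_measurable_continuous_onI continuous_intros continuous_on_product_coordinates)
  ultimately show ?thesis by (rule measurable_compose)
qed

lemma borel_measurable_ridge_feedback:
  assumes \<theta>: "continuous_on UNIV \<theta>" and "r > 0"
    and t: "t \<in> borel_measurable N" and v: "v \<in> borel_measurable N"
  shows "(\<lambda>x. ridge_feedback \<theta> n r L (t x) (v x)) \<in> borel_measurable N"
  unfolding ridge_feedback_def
proof (rule borel_measurable_coefficients)
  fix i
  let ?v = "\<lambda>x. radial_retraction r (P_proj n (v x))"
  have \<theta>_meas: "\<theta> \<in> borel_measurable borel"
    using \<theta> by (rule borel_measurable_continuous_onI)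
  have "continuous_on UNIV (\<lambda>u. radial_retraction r (P_proj n u))"
    by (rule continuous_on_compose2
        [OF lipschitz_on_continuous_on[OF lipschitz_radial_retraction[OF \<open>r > 0\<close>]]
          lipschitz_on_continuous_on[OF lipschitz_P_proj] subset_UNIV])
  then have "(\<lambda>x. inner w (?v x)) \<in> borel_measurable N" for w
    by (intro measurable_compose[OF v] borel_measurable_continuous_onI continuous_intros)
  then have arg: "(\<lambda>x. inner w (t x, ?v x) + b) \<in> borel_measurable N" for w :: "real \<times> L2" and b
    using t by (simp add: inner_prod_def)
  have "(\<lambda>x. ridge_sum \<theta> L' (t x, ?v x)) \<in> borel_measurable N" for L'
  proof (induction L')
    case Nil
    show ?case by simp
  next
    case (Cons p L')
    obtain c w b where p: "p = (c, w, b)" by (cases p) auto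
    have "(\<lambda>x. \<theta> (inner w (t x, ?v x) + b)) \<in> borel_measurable N"
      using arg \<theta>_meas by (rule measurable_compose)
    then show ?case
      unfolding p ridge_sum_Cons by (intro borel_measurable_add borel_measurable_times Cons.IH) simp_all
  qed
  then show "(\<lambda>x. ridge_sum \<theta> (L i) (t x, ?v x)) \<in> borel_measurable N" .
qed

lemma control_space_cong:
  assumes "\<And>t \<omega>. t \<in> {0..T} \<Longrightarrow> g t \<omega> = h t \<omega>" and g: "g \<in> control_space T M F"
  shows "h \<in> control_space T M F"
proof -
  let ?N = "lebesgue_on {0..T} \<Otimes>\<^sub>M M"
  have eq: "h (fst x) (snd x) = g (fst x) (snd x)" if "x \<in> space ?N" for x
    using that assms(1)[of "fst x" "snd x"] by (auto simp: space_pair_measure)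
  have "(\<lambda>(t, \<omega>). h t \<omega>) \<in> borel_measurable ?N \<longleftrightarrow> (\<lambda>(t, \<omega>). g t \<omega>) \<in> borel_measurable ?N"
    by (intro measurable_cong) (simp add: case_prod_unfold eq)
  moreover have "integrable ?N (\<lambda>(t, \<omega>). (norm (h t \<omega>))\<^sup>2) \<longleftrightarrow>
      integrable ?N (\<lambda>(t, \<omega>). (norm (g t \<omega>))\<^sup>2)"
    by (intro Bochner_Integration.integrable_cong refl) (simp add: case_prod_unfold eq)
  moreover have "h t = g t" if "t \<in> {0..T}" for t
    using assms(1)[OF that] by (simp add: fun_eq_iff)
  ultimately show ?thesis
    using g by (simp add: control_space_def measurable_adapted_def)
qed

text \<open>The Lipschitz bound gives growth of at most first order, so square integrability passes from the
  state to the control, the measure of \<open>{0..T} \<times> \<Omega>\<close> being finite.\<close>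

lemma ridge_feedback_in_control_space:
  assumes M: "prob_space M" and \<theta>: "K-lipschitz_on UNIV \<theta>" and "r > 0"
    and u: "u \<in> control_space T M F"
  shows "(\<lambda>t \<omega>. ridge_feedback \<theta> n r L t (u t \<omega>)) \<in> control_space T M F"
proof -
  let ?\<Phi> = "ridge_feedback \<theta> n r L"
  let ?N = "lebesgue_on {0..T} \<Otimes>\<^sub>M M"
  interpret prob_space M by (rule M)
  interpret time: finite_measure "lebesgue_on {0..T}"
    by (rule finite_measure_lebesgue_on) simp
  interpret prod: finite_measure ?N
    by (rule finite_measure_pair_measure) unfold_locales
  have cont: "continuous_on UNIV \<theta>" using \<theta> by (rule lipschitz_on_continuous_on)
  have u_meas: "(\<lambda>x. u (fst x) (snd x)) \<in> borel_measurable ?N"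
    and u_adapted: "\<And>t. t \<in> {0..T} \<Longrightarrow> u t \<in> borel_measurable (F t)"
    and u_int: "integrable ?N (\<lambda>x. (norm (u (fst x) (snd x)))\<^sup>2)"
    using u by (auto simp: control_space_def measurable_adapted_def case_prod_unfold)
  have "(\<lambda>t. t) \<in> borel_measurable (lebesgue_on {0..T})"
    by (intro measurable_restrict_space1 measurable_completion) simp
  then have time_meas: "fst \<in> borel_measurable ?N"
    by (rule measurable_compose[OF measurable_fst])
  have meas: "(\<lambda>x. ?\<Phi> (fst x) (u (fst x) (snd x))) \<in> borel_measurable ?N"
    by (rule borel_measurable_ridge_feedback[OF cont \<open>r > 0\<close> time_meas u_meas])
  obtain C where C: "C-lipschitz_on UNIV (\<lambda>(t, u). ?\<Phi> t u)"
    using lipschitz_ridge_feedback[OF \<theta> \<open>r > 0\<close>] by blast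
  define a where "a = norm (?\<Phi> 0 0) + C * T"
  have bound: "(norm (?\<Phi> t v))\<^sup>2 \<le> 2 * a\<^sup>2 + 2 * C\<^sup>2 * (norm v)\<^sup>2" if "t \<in> {0..T}" for t v
  proof -
    have "norm (?\<Phi> t v - ?\<Phi> 0 0) \<le> C * dist (t, v) (0, 0)"
      using lipschitz_onD[OF C, of "(t, v)" "(0, 0)"] by (simp add: dist_norm)
    also have "\<dots> \<le> C * (T + norm v)"
      using that sqrt_sum_squares_le_sum_abs[of t "norm v"]
      by (intro mult_left_mono lipschitz_on_nonneg[OF C]) (simp add: dist_prod_def)
    finally have "norm (?\<Phi> t v) \<le> a + C * norm v"
      using norm_triangle_ineq2[of "?\<Phi> t v" "?\<Phi> 0 0"] by (simp add: a_def distrib_left)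
    then have "(norm (?\<Phi> t v))\<^sup>2 \<le> (a + C * norm v)\<^sup>2"
      by (intro power_mono) auto
    also have "\<dots> \<le> 2 * a\<^sup>2 + 2 * (C * norm v)\<^sup>2"
      using zero_le_power2[of "a - C * norm v"] by (simp add: power2_sum power2_diff)
    finally show ?thesis by (simp add: power_mult_distrib)
  qed
  have "integrable ?N (\<lambda>x. (norm (?\<Phi> (fst x) (u (fst x) (snd x))))\<^sup>2)"
  proof (rule Bochner_Integration.integrable_bound)
    show "integrable ?N (\<lambda>x. 2 * a\<^sup>2 + 2 * C\<^sup>2 * (norm (u (fst x) (snd x)))\<^sup>2)"
      using u_int by simp
    show "(\<lambda>x. (norm (?\<Phi> (fst x) (u (fst x) (snd x))))\<^sup>2) \<in> borel_measurable ?N"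
      by (rule measurable_compose[OF meas])
        (intro borel_measurable_continuous_onI continuous_intros)
    show "AE x in ?N. norm ((norm (?\<Phi> (fst x) (u (fst x) (snd x))))\<^sup>2) \<le>
        norm (2 * a\<^sup>2 + 2 * C\<^sup>2 * (norm (u (fst x) (snd x)))\<^sup>2)"
    proof (rule AE_I2)
      fix x assume "x \<in> space ?N"
      then have "fst x \<in> {0..T}" by (auto simp: space_pair_measure)
      from bound[OF this, of "u (fst x) (snd x)"]
      show "norm ((norm (?\<Phi> (fst x) (u (fst x) (snd x))))\<^sup>2) \<le>
        norm (2 * a\<^sup>2 + 2 * C\<^sup>2 * (norm (u (fst x) (snd x)))\<^sup>2)" by simp
    qed
  qed
  moreover have "(\<lambda>\<omega>. ?\<Phi> t (u t \<omega>)) \<in> borel_measurable (F t)" if "t \<in> {0..T}" for t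
    by (intro borel_measurable_ridge_feedback cont \<open>r > 0\<close> u_adapted that) simp
  ultimately show ?thesis
    using meas by (simp add: control_space_def measurable_adapted_def case_prod_unfold)
qed

lemma network_feedbacks_admissible:
  assumes M: "prob_space M" and \<theta>: "K-lipschitz_on UNIV \<theta>"
    and standing: "standing_assumption T M F W \<sigma> f u0"
  shows "network_feedbacks T \<theta> \<subseteq> U_ad T M F W \<sigma> f u0"
proof
  fix G assume "G \<in> network_feedbacks T \<theta>"
  then obtain n r L where "r > 0"
    and G: "\<And>t u. t \<in> {0..T} \<Longrightarrow> G t u = ridge_feedback \<theta> n r L t u"
    using network_feedbacks_subset by blast
  obtain C where C: "C-lipschitz_on UNIV (\<lambda>(t, u). ridge_feedback \<theta> n r L t u)"
    using lipschitz_ridge_feedback[OF \<theta> \<open>r > 0\<close>] by blast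
  have "continuous_on ({0..T} \<times> UNIV) (\<lambda>(t, u). ridge_feedback \<theta> n r L t u)"
    using lipschitz_on_continuous_on[OF C] by (rule continuous_on_subset) simp
  then have "continuous_on ({0..T} \<times> UNIV) (\<lambda>(t, u). G t u)"
    by (rule continuous_on_eq) (auto simp: G)
  moreover have "C-lipschitz_on UNIV (G t)" if "t \<in> {0..T}" for t
  proof (rule lipschitz_onI)
    fix u v
    show "dist (G t u) (G t v) \<le> C * dist u v"
      using lipschitz_onD[OF C, of "(t, u)" "(t, v)"] by (simp add: G[OF that] dist_prod_def)
  qed (rule lipschitz_on_nonneg[OF C])
  ultimately obtain u where u: "unique_solution T M F W \<sigma> f u0 G u" "u \<in> control_space T M F"
    using standing unfolding standing_assumption_def by blast
  have "(\<lambda>t \<omega>. G t (u t \<omega>)) \<in> control_space T M F"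
    by (rule control_space_cong[OF _ ridge_feedback_in_control_space[OF M \<theta> \<open>r > 0\<close> u(2)]])
      (simp add: G)
  with u(1) show "G \<in> U_ad T M F W \<sigma> f u0"
    unfolding U_ad_def by blast
qed

section \<open>Approximation of continuous feedbacks\<close>

text \<open>Although \<^typ>\<open>L2\<close> is infinite-dimensional, the retracted projections stay in a compact set, a sum of
  finitely many segments.\<close>

lemma compact_basis_box:
  "\<exists>K :: L2 set. compact K \<and> (\<forall>c. (\<forall>i\<le>n. \<bar>c i\<bar> \<le> r) \<longrightarrow> (\<Sum>i\<le>n. c i *\<^sub>R e_basis i) \<in> K)"
proof (induction n)
  case 0
  have "compact ((\<lambda>a. a *\<^sub>R e_basis 0) ` {-r..r})"
    by (intro compact_continuous_image continuous_intros) simp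
  then show ?case by (intro exI conjI) (auto simp: abs_le_iff)
next
  case (Suc n)
  then obtain K where K: "compact K"
    "\<And>c. \<forall>i\<le>n. \<bar>c i\<bar> \<le> r \<Longrightarrow> (\<Sum>i\<le>n. c i *\<^sub>R e_basis i) \<in> K" by blast
  define I where "I = (\<lambda>a. a *\<^sub>R e_basis (Suc n)) ` {-r..r}"
  have "compact I"
    unfolding I_def by (intro compact_continuous_image continuous_intros) simp
  then have "compact {x + y |x y. x \<in> K \<and> y \<in> I}"
    by (rule compact_sums[OF K(1)])
  moreover have "(\<Sum>i\<le>Suc n. c i *\<^sub>R e_basis i) \<in> {x + y |x y. x \<in> K \<and> y \<in> I}"
    if c: "\<forall>i\<le>Suc n. \<bar>c i\<bar> \<le> r" for c
  proof -
    have "(\<Sum>i\<le>n. c i *\<^sub>R e_basis i) \<in> K" using c by (intro K(2)) simp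
    moreover have "c (Suc n) *\<^sub>R e_basis (Suc n) \<in> I"
      using c[rule_format, of "Suc n"] unfolding I_def by (intro imageI) auto
    ultimately show ?thesis by auto
  qed
  ultimately show ?case by blast
qed

lemma compact_superset_radial_retraction:
  assumes "r \<ge> 0"
  shows "\<exists>K. compact K \<and> (\<forall>u. radial_retraction r (P_proj n u) \<in> K)"
proof -
  obtain K where "compact K"
    and K: "\<And>c. \<forall>i\<le>n. \<bar>c i\<bar> \<le> r \<Longrightarrow> (\<Sum>i\<le>n. c i *\<^sub>R e_basis i) \<in> K"
    using compact_basis_box by blast
  have "radial_retraction r (P_proj n u) \<in> K" for u
  proof -
    define v where "v = radial_retraction r (P_proj n u)"
    have "\<bar>inner v (e_basis i)\<bar> \<le> r" for i
      using Cauchy_Schwarz_ineq2[of v "e_basis i"] norm_radial_retraction_le(1)[OF assms, of "P_proj n u"]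
      by (simp add: norm_e_basis v_def)
    then have "P_proj n v \<in> K" unfolding P_proj_eq by (intro K) simp
    then show ?thesis by (simp add: v_def P_proj_radial_retraction)
  qed
  with \<open>compact K\<close> show ?thesis by blast
qed

text \<open>The universal approximation theorem is applied in \<open>real \<times> L2\<close> to each basis coefficient of \<open>G\<close> on
  the product of \<open>{0..T}\<close> with a compact set containing all retracted projections. The bound is
  therefore uniform over every \<open>u\<close>, not only over bounded sets.\<close>

lemma exists_ridge_feedback:
  assumes \<theta>: "continuous_on UNIV \<theta>" "\<nexists>p :: real poly. \<forall>x. \<theta> x = poly p x"
    and G: "continuous_on ({0..T} \<times> UNIV) (\<lambda>(t, u). G t u)"
    and "r \<ge> 0" "\<delta> > 0"
  shows "\<exists>L. \<forall>t\<in>{0..T}. \<forall>u. norm (P_proj n (G t (radial_retraction r (P_proj n u)))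
    - ridge_feedback \<theta> n r L t u) \<le> \<delta>"
proof -
  obtain K where "compact K" and K: "\<And>u. radial_retraction r (P_proj n u) \<in> K"
    using compact_superset_radial_retraction[OF \<open>r \<ge> 0\<close>] by blast
  define g where "g i x = inner (G (fst x) (snd x)) (e_basis i)" for i x
  have "approximable \<theta> ({0..T} \<times> K) (g i)" for i
  proof (rule universal_approximation[OF \<theta>])
    show "compact ({0..T} \<times> K)" using \<open>compact K\<close> by (intro compact_Times) auto
    have "continuous_on ({0..T} \<times> K) (\<lambda>x. G (fst x) (snd x))"
      using continuous_on_subset[OF G, of "{0..T} \<times> K"] by (auto simp: case_prod_unfold)
    then show "continuous_on ({0..T} \<times> K) (g i)"
      unfolding g_def by (intro continuous_intros)
  qed
  moreover have "\<delta> / (real n + 1) > 0" using \<open>\<delta> > 0\<close> by simp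
  ultimately have "\<forall>i. \<exists>L. \<forall>x\<in>{0..T} \<times> K. \<bar>g i x - ridge_sum \<theta> L x\<bar> \<le> \<delta> / (real n + 1)"
    unfolding approximable_def by blast
  then obtain L where
    L: "\<And>i x. x \<in> {0..T} \<times> K \<Longrightarrow> \<bar>g i x - ridge_sum \<theta> (L i) x\<bar> \<le> \<delta> / (real n + 1)"
    by metis
  have "norm (P_proj n (G t (radial_retraction r (P_proj n u))) - ridge_feedback \<theta> n r L t u) \<le> \<delta>"
    if "t \<in> {0..T}" for t u
  proof -
    let ?x = "(t, radial_retraction r (P_proj n u))"
    have "P_proj n (G t (radial_retraction r (P_proj n u))) - ridge_feedback \<theta> n r L t u =
        (\<Sum>i\<le>n. (g i ?x - ridge_sum \<theta> (L i) ?x) *\<^sub>R e_basis i)"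
      by (simp add: P_proj_eq[of n "G t _"] ridge_feedback_def g_def sum_subtractf scaleR_left_diff_distrib)
    also have "norm \<dots> \<le> (\<Sum>i\<le>n. norm ((g i ?x - ridge_sum \<theta> (L i) ?x) *\<^sub>R e_basis i))"
      by (rule norm_sum)
    also have "\<dots> \<le> (\<Sum>i\<le>n. \<delta> / (real n + 1))"
      using that K by (intro sum_mono) (simp add: norm_e_basis L)
    also have "\<dots> = \<delta>"
      by (simp add: field_simps)
    finally show ?thesis .
  qed
  then show ?thesis by blast
qed

text \<open>The radius and the accuracy are coupled: \<open>Suc m\<close> and \<open>1 / Suc m\<close>. Linear growth is
  independent of \<open>m\<close> because the retraction does not increase norms and the error is at most \<open>1\<close>. Once
  \<open>Suc m\<close> exceeds \<open>R\<close>, the retraction is the identity on the projected ball, and what remains is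
  the approximation error.\<close>

lemma network_feedbacks_uniform_approximation:
  assumes \<theta>: "continuous_on UNIV \<theta>" "\<nexists>p :: real poly. \<forall>x. \<theta> x = poly p x"
    and G: "continuous_on ({0..T} \<times> UNIV) (\<lambda>(t, u). G t u)"
    and growth: "C > 0" "\<And>t u. t \<in> {0..T} \<Longrightarrow> norm (G t u) \<le> C * (1 + norm u)"
  shows "uniform_approximation_property T (network_feedbacks T \<theta>) G"
proof -
  have "\<forall>n m. \<exists>L. \<forall>t\<in>{0..T}. \<forall>u.
      norm (P_proj n (G t (radial_retraction (real (Suc m)) (P_proj n u)))
        - ridge_feedback \<theta> n (real (Suc m)) L t u) \<le> 1 / real (Suc m)"
    by (intro allI exists_ridge_feedback[OF \<theta> G]) simp_all
  then obtain L where L: "\<And>n m t u. t \<in> {0..T} \<Longrightarrow>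
      norm (P_proj n (G t (radial_retraction (real (Suc m)) (P_proj n u)))
        - ridge_feedback \<theta> n (real (Suc m)) (L n m) t u) \<le> 1 / real (Suc m)"
    by metis
  define H where "H n m = ridge_feedback \<theta> n (real (Suc m)) (L n m)" for n m
  have member: "H n m \<in> network_feedbacks T \<theta>" for n m
    unfolding H_def by (rule ridge_feedback_in_network_feedbacks) simp
  have bound: "norm (H n m t u) \<le> (C + 1) * (1 + norm u)" if t: "t \<in> {0..T}" for n m t u
  proof -
    let ?v = "radial_retraction (real (Suc m)) (P_proj n u)"
    have "norm (P_proj n (G t ?v) - H n m t u) \<le> 1 / real (Suc m)"
      unfolding H_def by (rule L[OF t])
    also have "\<dots> \<le> 1" by simp
    finally have "norm (H n m t u) \<le> norm (P_proj n (G t ?v)) + 1"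
      using norm_triangle_ineq3[of "H n m t u" "P_proj n (G t ?v)"]
      by (simp add: norm_minus_commute)
    moreover have "norm (P_proj n (G t ?v)) \<le> C * (1 + norm ?v)"
      using norm_P_proj_le growth(2)[OF t] by (rule order_trans)
    moreover have "norm ?v \<le> norm u"
      using norm_radial_retraction_le(2)[of "real (Suc m)" "P_proj n u"] norm_P_proj_le[of n u]
      by simp
    then have "C * (1 + norm ?v) \<le> C * (1 + norm u)"
      using \<open>C > 0\<close> by simp
    moreover have "(C + 1) * (1 + norm u) = C * (1 + norm u) + 1 + norm u"
      by (simp add: algebra_simps)
    ultimately show ?thesis
      using norm_ge_zero[of u] by linarith
  qed
  have limit: "(\<lambda>m. SUP (t, u)\<in>{0..T} \<times> {u. norm u \<le> R}.
      ennreal ((norm (finitely_based G n t u - H n m t u))\<^sup>2)) \<longlonglongrightarrow> 0" for R n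
  proof (rule tendsto_sandwich[where f = "\<lambda>_. 0"])
    let ?S = "\<lambda>m. SUP (t, u)\<in>{0..T} \<times> {u. norm u \<le> R}.
      ennreal ((norm (finitely_based G n t u - H n m t u))\<^sup>2)"
    show "\<forall>\<^sub>F m in sequentially. ?S m \<le> ennreal ((1 / real (Suc m))\<^sup>2)"
    proof (rule eventually_sequentiallyI)
      fix m assume m: "nat \<lceil>R\<rceil> \<le> m"
      have "(norm (finitely_based G n t u - H n m t u))\<^sup>2 \<le> (1 / real (Suc m))\<^sup>2"
        if "t \<in> {0..T}" "norm u \<le> R" for t u
      proof -
        have "norm (P_proj n u) \<le> real (Suc m)"
          using norm_P_proj_le[of n u] that(2) m by linarith
        then have "radial_retraction (real (Suc m)) (P_proj n u) = P_proj n u"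
          by (simp add: radial_retraction_def)
        then show ?thesis
          using L[OF that(1), of n m u] unfolding H_def finitely_based_def
          by (intro power_mono) auto
      qed
      then show "?S m \<le> ennreal ((1 / real (Suc m))\<^sup>2)"
        by (auto intro!: SUP_least ennreal_leI)
    qed
    have "(\<lambda>m. 1 / real (Suc m)) \<longlonglongrightarrow> 0"
      using LIMSEQ_inverse_real_of_nat by (simp add: inverse_eq_divide)
    then have "(\<lambda>m. (1 / real (Suc m))\<^sup>2) \<longlonglongrightarrow> 0\<^sup>2"
      by (rule tendsto_power)
    then have "(\<lambda>m. ennreal ((1 / real (Suc m))\<^sup>2)) \<longlonglongrightarrow> ennreal (0\<^sup>2)"
      by (rule tendsto_ennrealI)
    then show "(\<lambda>m. ennreal ((1 / real (Suc m))\<^sup>2)) \<longlonglongrightarrow> 0" by simp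
  qed simp_all
  show ?thesis
    unfolding uniform_approximation_property_def
  proof (intro exI[of _ H] conjI allI impI)
    show "\<exists>C>0. \<forall>m. \<forall>t\<in>{0..T}. \<forall>u. norm (H n m t u) \<le> C * (1 + norm u)" for n
      using \<open>C > 0\<close> by (intro exI[of _ "C + 1"] conjI allI ballI bound) simp_all
  qed (rule member limit)+
qed

theorem mainTheorem1:
  fixes T \<nu> :: real
    and M :: "'a measure"
    and F :: "real \<Rightarrow> 'a measure"
    and W :: "real \<Rightarrow> L2 \<Rightarrow> 'a \<Rightarrow> real"
    and \<sigma> :: "L2 \<Rightarrow> L2"
    and f \<theta> :: "real \<Rightarrow> real"
    and u0 :: L2
    and l :: "real \<Rightarrow> real \<Rightarrow> real \<Rightarrow> real"
    and m :: "real \<Rightarrow> real \<Rightarrow> real"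
    and G :: "real \<Rightarrow> L2 \<Rightarrow> L2"
  assumes "T > 0"
    and "filtered_probability_space M F"
    and "cylindrical_wiener T M F W"
    and "hilbert_schmidt \<sigma>"
    and "standing_assumption T M F W \<sigma> f u0"
    and "\<forall>t\<in>{0..T}. \<forall>x\<in>{0<..<1}. l t x differentiable_on UNIV \<and> locally_lipschitz (l t x)"
    and "\<forall>x\<in>{0<..<1}. m x differentiable_on UNIV \<and> locally_lipschitz (m x)"
    and "optimal_feedback T M F W \<sigma> f u0 l m \<nu> G"
    and "continuous_on ({0..T} \<times> UNIV) (\<lambda>(t, u). G t u)"
    and "\<exists>C>0. \<forall>t\<in>{0..T}. \<forall>u. norm (G t u) \<le> C * (1 + norm u)"
    and "\<exists>L. L-lipschitz_on UNIV \<theta>"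
    and "\<nexists>p :: real poly. \<forall>x. \<theta> x = poly p x"
  shows "network_feedbacks T \<theta> \<subseteq> U_ad T M F W \<sigma> f u0 \<and>
         uniform_approximation_property T (network_feedbacks T \<theta>) G"
proof
  obtain K where K: "K-lipschitz_on UNIV \<theta>" using assms(11) by blast
  have "prob_space M" using assms(2) by (simp add: filtered_probability_space_def)
  then show "network_feedbacks T \<theta> \<subseteq> U_ad T M F W \<sigma> f u0"
    using K assms(5) by (rule network_feedbacks_admissible)
  obtain C where "C > 0" "\<And>t u. t \<in> {0..T} \<Longrightarrow> norm (G t u) \<le> C * (1 + norm u)"
    using assms(10) by blast
  then show "uniform_approximation_property T (network_feedbacks T \<theta>) G"
    by (rule network_feedbacks_uniform_approximation
        [OF lipschitz_on_continuous_on[OF K] assms(12) assms(9)])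
qed

end
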